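(* For each $n$ let $G_n$ be an interval graph with $n$ vertices, and suppose that $G_n\to\Gamma$ as $n\to\infty$ for some graph limit $\Gamma$. Then $$\frac1n\chi(G_n)=\frac1n\omega(G_n)\to\omega(\Gamma)\qquad\text{as }n\to\infty.$$
   Context: Graphs are finite, simple and undirected; $|G|$ is the number of vertices, $\chi(G)$ the chromatic number and $\omega(G)$ the clique number (maximal size of a clique). A graph $G$ is an interval graph if there are intervals $\{I_i\}_{i\in V(G)}$ such that for all $i\ne j$, $ij\in E(G)$ if and only if $I_i\cap I_j\neq\emptyset$. For graphs $F,G$, $t(F,G)$ is the probability that a uniformly random map $V(F)\to V(G)$ is a graph homomorphism. A graph limit $\Gamma$ is the limit of a sequence of graphs $G_n$ with $|G_n|\to\infty$ for which $t(F,G_n)$ converges for every graph $F$; it is determined by the numbers $t(F,\Gamma)=\lim_n t(F,G_n)$. $G_n\to\Gamma$ means $|G_n|\to\infty$ and $t(F,G_n)\to t(F,\Gamma)$ for every graph $F$. An interval graph limit is a graph limit $\Gamma$ with $G_n\to\Gamma$ for some sequence of interval graphs $G_n$. $\mathcal S=\{[a,b]:0\le a\le b\le1\}$ is the set of non-empty closed subintervals of $[0,1]$ (length $0$ allowed), identified with the triangle $\{(a,b):0\le a\le b\le 1\}\subset\mathbb R^2$; $W(I,J)=1$ if $I\cap J\ne\emptyset$ and $0$ otherwise. $\mathcal P(\mathcal S)$ is the set of Borel probability measures on $\mathcal S$. For $\mu\in\mathcal P(\mathcal S)$, $\Gamma_\mu$ is the unique graph limit with $t(F,\Gamma_\mu)=\int_{\mathcal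 S^{|F|}}\prod_{ij\in E(F)}W(x_i,x_j)\,d\mu(x_1)\cdots d\mu(x_{|F|})$ for every graph $F$. For $\mu\in\mathcal P(\mathcal S)$ define $$\omega(\mu)=\sup_{a\in[0,1]}\mu\{I\in\mathcal S:a\in I\}=\sup_{a\in[0,1]}\mu\bigl([0,a]\times[a,1]\bigr).$$ Every interval graph limit $\Gamma$ equals $\Gamma_\mu$ for some $\mu\in\mathcal P(\mathcal S)$, and $\omega(\mu)$ is the same for all $\mu$ with $\Gamma_\mu=\Gamma$; the clique number of $\Gamma$ is defined by $\omega(\Gamma)=\omega(\mu)$ for any such $\mu$. *)

theory Defs
  imports "HOL-Probability.Probability" "Graph_Theory.Pair_Digraph"
begin

text \<open>A finite simple undirected graph is a \<open>pair_graph\<close>: a finite, loop-free, symmetric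
  digraph whose arcs are pairs of vertices. Each undirected edge \<open>ij\<close> is represented by
  the two arcs \<open>(i, j)\<close> and \<open>(j, i)\<close>.\<close>

definition is_clique :: "'a pair_pre_digraph \<Rightarrow> 'a set \<Rightarrow> bool" where
  "is_clique G C \<longleftrightarrow> C \<subseteq> pverts G \<and> (\<forall>i\<in>C. \<forall>j\<in>C. i \<noteq> j \<longrightarrow> (i, j) \<in> parcs G)"

definition clique_number :: "'a pair_pre_digraph \<Rightarrow> nat" where
  "clique_number G = Max (card ` {C. is_clique G C})"

definition proper_colouring :: "'a pair_pre_digraph \<Rightarrow> nat \<Rightarrow> ('a \<Rightarrow> nat) \<Rightarrow> bool" where
  "proper_colouring G k c \<longleftrightarrow>
     (\<forall>i\<in>pverts G. c i < k) \<and> (\<forall>(i, j)\<in>parcs G. c i \<noteq> c j)"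

definition chromatic_number :: "'a pair_pre_digraph \<Rightarrow> nat" where
  "chromatic_number G = (LEAST k. \<exists>c. proper_colouring G k c)"

text \<open>The intervals are arbitrary intervals of the real line: open, closed, half-open,
  bounded or not.\<close>

definition interval_graph :: "'a pair_pre_digraph \<Rightarrow> bool" where
  "interval_graph G \<longleftrightarrow> pair_graph G \<and>
     (\<exists>I :: 'a \<Rightarrow> real set. (\<forall>i\<in>pverts G. is_interval (I i)) \<and>
        (\<forall>i\<in>pverts G. \<forall>j\<in>pverts G. i \<noteq> j \<longrightarrow>
           ((i, j) \<in> parcs G \<longleftrightarrow> I i \<inter> I j \<noteq> {})))"

definition graph_homs :: "'a pair_pre_digraph \<Rightarrow> 'b pair_pre_digraph \<Rightarrow> ('a \<Rightarrow> 'b) set" where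
  "graph_homs F G = {\<phi> \<in> pverts F \<rightarrow>\<^sub>E pverts G. \<forall>(i, j)\<in>parcs F. (\<phi> i, \<phi> j) \<in> parcs G}"

text \<open>The probability \<open>t(F, G)\<close> that a uniformly random map \<open>V(F) \<rightarrow> V(G)\<close> is a homomorphism.\<close>

definition hom_density :: "'a pair_pre_digraph \<Rightarrow> 'b pair_pre_digraph \<Rightarrow> real" where
  "hom_density F G = real (card (graph_homs F G)) / real (card (pverts F \<rightarrow>\<^sub>E pverts G))"

text \<open>A graph limit is determined by its densities \<open>t(F, \<Gamma>)\<close>, so it is encoded as the function
  \<open>F \<mapsto> t(F, \<Gamma>)\<close>. The test graphs \<open>F\<close> are all finite simple graphs with vertices
  in \<^typ>\<open>nat\<close>, which covers every isomorphism class; the value is fixed to \<open>0\<close> on the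
  records that are not graphs, so that equality of graph limits is equality of the densities.\<close>

typedef graph_limit =
  "{\<tau> :: nat pair_pre_digraph \<Rightarrow> real.
      (\<forall>F. \<not> pair_graph F \<longrightarrow> \<tau> F = 0) \<and>
      (\<exists>G :: nat \<Rightarrow> nat pair_pre_digraph.
         (\<forall>n. pair_graph (G n)) \<and>
         filterlim (\<lambda>n. card (pverts (G n))) at_top sequentially \<and>
         (\<forall>F. pair_graph F \<longrightarrow> (\<lambda>n. hom_density F (G n)) \<longlonglongrightarrow> \<tau> F))}"
  morphisms limit_density Abs_graph_limit
proof -
  define G :: "nat \<Rightarrow> nat pair_pre_digraph" where "G n = \<lparr>pverts = {..<Suc n}, parcs = {}\<rparr>" for n
  define \<tau> :: "nat pair_pre_digraph \<Rightarrow> real" where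
    "\<tau> F = (if pair_graph F \<and> parcs F = {} then 1 else 0)" for F
  have G: "pair_graph (G n)" for n
    by unfold_locales (auto simp: G_def symmetric_def arcs_ends_def with_proj_def intro!: symI)
  have d: "hom_density F (G n) = \<tau> F" if F: "pair_graph F" for F n
  proof (cases "parcs F = {}")
    case True
    have "finite (pverts F)"
      using F by (simp add: pair_graph_def pair_digraph_def pair_fin_digraph.pair_finite_verts)
    then have "card (pverts F \<rightarrow>\<^sub>E {..<Suc n}) \<noteq> 0"
      by (simp add: card_PiE)
    then show ?thesis
      using True F by (simp add: hom_density_def graph_homs_def \<tau>_def G_def)
  next
    case False
    then have "graph_homs F (G n) = {}"
      by (auto simp: graph_homs_def G_def)
    then show ?thesis
      using False by (simp add: hom_density_def \<tau>_def)
  qed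
  have "filterlim (\<lambda>n. card (pverts (G n))) at_top sequentially"
    by (simp add: G_def filterlim_Suc)
  moreover have "\<forall>F. \<not> pair_graph F \<longrightarrow> \<tau> F = 0"
    by (simp add: \<tau>_def)
  moreover have "\<forall>F. pair_graph F \<longrightarrow> (\<lambda>n. hom_density F (G n)) \<longlonglongrightarrow> \<tau> F"
    by (simp add: d)
  ultimately show ?thesis
    using G by blast
qed

definition converges_to_limit :: "(nat \<Rightarrow> 'a pair_pre_digraph) \<Rightarrow> graph_limit \<Rightarrow> bool" where
  "converges_to_limit G \<Gamma> \<longleftrightarrow>
     filterlim (\<lambda>n. card (pverts (G n))) at_top sequentially \<and>
     (\<forall>F. pair_graph F \<longrightarrow> (\<lambda>n. hom_density F (G n)) \<longlonglongrightarrow> limit_density \<Gamma> F)"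

text \<open>The interval \<open>[a, b]\<close> is encoded as the pair \<open>(a, b)\<close>.\<close>

definition \<S> :: "(real \<times> real) set" where
  "\<S> = {(a, b). 0 \<le> a \<and> a \<le> b \<and> b \<le> 1}"

definition W :: "real \<times> real \<Rightarrow> real \<times> real \<Rightarrow> real" where
  "W I J = (if {fst I..snd I} \<inter> {fst J..snd J} \<noteq> {} then 1 else 0)"

definition \<P>\<S> :: "(real \<times> real) measure set" where
  "\<P>\<S> = {\<mu>. prob_space \<mu> \<and> sets \<mu> = sets (restrict_space borel \<S>)}"

text \<open>The restriction \<open>i < j\<close> makes the product take each undirected edge once.\<close>

definition measure_density :: "nat pair_pre_digraph \<Rightarrow> (real \<times> real) measure \<Rightarrow> real" where
  "measure_density F \<mu> =
     (\<integral>x. (\<Prod>(i, j)\<in>{(i, j)\<in>parcs F. i < j}. W (x i) (x j)) \<partial>(\<Pi>\<^sub>M i\<in>pverts F. \<mu>))"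

text \<open>The defining property of \<open>\<Gamma>\<^sub>\<mu>\<close>, i.e. \<open>\<Gamma>\<^sub>\<mu> = \<Gamma>\<close>; at most one
  graph limit satisfies it for a given \<open>\<mu>\<close> by \<open>is_limit_of_measure_unique\<close>.\<close>

definition is_limit_of_measure :: "(real \<times> real) measure \<Rightarrow> graph_limit \<Rightarrow> bool" where
  "is_limit_of_measure \<mu> \<Gamma> \<longleftrightarrow>
     (\<forall>F. pair_graph F \<longrightarrow> limit_density \<Gamma> F = measure_density F \<mu>)"

lemma is_limit_of_measure_unique:
  assumes "is_limit_of_measure \<mu> \<Gamma>" "is_limit_of_measure \<mu> \<Gamma>'"
  shows "\<Gamma> = \<Gamma>'"
proof -
  have "limit_density \<Gamma> F = limit_density \<Gamma>' F" for F
    using assms limit_density[of \<Gamma>] limit_density[of \<Gamma>']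
    by (cases "pair_graph F") (auto simp: is_limit_of_measure_def)
  then show ?thesis
    by (simp add: limit_density_inject[symmetric] fun_eq_iff)
qed

definition measure_clique_number :: "(real \<times> real) measure \<Rightarrow> real" where
  "measure_clique_number \<mu> = (SUP a\<in>{0..1}. measure \<mu> {I\<in>\<S>. a \<in> {fst I..snd I}})"

text \<open>The value for any \<open>\<mu>\<close> with \<open>\<Gamma>\<^sub>\<mu> = \<Gamma>\<close>. Such a \<open>\<mu>\<close> exists when \<open>\<Gamma>\<close> is an interval
  graph limit, and the value does not depend on its choice; for other graph limits the
  value carries no meaning.\<close>

definition limit_clique_number :: "graph_limit \<Rightarrow> real" where
  "limit_clique_number \<Gamma> =
     measure_clique_number (SOME \<mu>. \<mu> \<in> \<P>\<S> \<and> is_limit_of_measure \<mu> \<Gamma>)"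

end

theory Submission
  imports Defs
begin

text \<open>
Write \<open>w\<close> for the clique number of a graph or of a measure, and \<open>t k\<close> for the density of the complete
graph on \<open>k\<close> vertices. The clique number is determined by these densities: for an interval graph
with \<open>n\<close> vertices
  \<open>((w - k) / n) ^ k \<le> t k \<le> k * (w / n) ^ (k - 1)\<close>,
the left inequality if \<open>k \<le> w\<close>, and for a measure on intervals
  \<open>w ^ k \<le> t k \<le> k * w ^ (k - 1)\<close>.
The lower bounds choose all vertices in a maximum clique, or all intervals through one point. The upper
bounds use that among pairwise intersecting intervals all contain the largest left endpoint. As
\<open>t k\<close> converges along the graphs for each \<open>k\<close>, the scaled clique numbers have to converge to the \<open>w\<close>
of any measure that represents the limit
(\<open>clique_density_squeeze\<close>). In particular \<open>w\<close> is the same for all representing measures.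

It remains to see that some measure represents the limit (\<open>interval_limit_representation\<close>). Order the
vertices by left endpoint and represent vertex \<open>i\<close> by \<open>[i / n, r / n]\<close>, where \<open>r\<close> is its last neighbour.
By compactness the laws of the interval of a random vertex converge weakly along a
subsequence. To get this from the theorems of Helly and Skorohod for the real line, the triangle of
intervals is parametrized by a space-filling curve. The limit law has no atoms in the left endpoint,
because the left endpoints are evenly spaced, and so two independent intervals almost surely avoid
the discontinuities of \<open>W\<close>; hence all densities converge to those of the limit law.

Equality of chromatic number and clique number comes from greedy colouring in the same order, since
the earlier neighbours of a vertex form a clique together with it.
\<close>

section \<open>Finite interval graphs\<close>

lemma pair_graph_finite: "pair_graph G \<Longrightarrow> finite (pverts G)"
  by (simp add: pair_graph_def pair_digraph_def pair_fin_digraph.pair_finite_verts)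

lemma pair_graph_finite_arcs: "pair_graph G \<Longrightarrow> finite (parcs G)"
  by (simp add: pair_graph_def pair_digraph_def pair_fin_digraph.pair_finite_arcs)

lemma pair_graph_arcs:
  assumes "pair_graph G"
  shows "(u, v) \<in> parcs G \<Longrightarrow> u \<in> pverts G \<and> v \<in> pverts G \<and> u \<noteq> v \<and> (v, u) \<in> parcs G"
proof -
  interpret pair_graph G by fact
  assume uv: "(u, v) \<in> parcs G"
  then have "u \<noteq> v" using pair_no_loops[OF uv] by simp
  moreover have "(v, u) \<in> parcs G" using uv arcs_symmetric by blast
  ultimately show "u \<in> pverts G \<and> v \<in> pverts G \<and> u \<noteq> v \<and> (v, u) \<in> parcs G"
    using in_arcsD1[OF uv] in_arcsD2[OF uv] by simp
qed

lemma pair_graph_sym: "pair_graph G \<Longrightarrow> (u, v) \<in> parcs G \<longleftrightarrow> (v, u) \<in> parcs G"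
  using pair_graph_arcs[of G u v] pair_graph_arcs[of G v u] by iprover

text \<open>The purely combinatorial form of a family of intervals: vertices are enumerated by left endpoint,
and an interval that reaches a later interval meets everything that starts in between. All
arguments about finite interval graphs use only such an enumeration.\<close>

definition interval_ordering :: "'a pair_pre_digraph \<Rightarrow> (nat \<Rightarrow> 'a) \<Rightarrow> bool" where
  "interval_ordering G e \<longleftrightarrow> pair_graph G \<and> bij_betw e {..<card (pverts G)} (pverts G) \<and>
     (\<forall>i j k. i < j \<and> j < k \<and> k < card (pverts G) \<and> (e i, e k) \<in> parcs G \<longrightarrow> (e i, e j) \<in> parcs G)"

text \<open>The upward closures of the intervals form a chain, whatever their endpoints are like, so the
vertices can be sorted by decreasing closure; this is ordering by left endpoint, with empty
intervals last and without a case distinction between open and closed ends. If \<open>u\<close> and \<open>w\<close> share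
a point \<open>x\<close> and \<open>v\<close> comes between them, then \<open>v\<close> has a point \<open>y \<le> x\<close> and \<open>u\<close> has a point below
\<open>y\<close>, so \<open>y\<close> lies in both by convexity.\<close>

lemma interval_graph_imp_ordering:
  fixes G :: "'a pair_pre_digraph"
  assumes "interval_graph G"
  obtains e where "interval_ordering G e"
proof -
  have G: "pair_graph G" using assms by (simp add: interval_graph_def)
  have fin: "finite (pverts G)" using pair_graph_finite[OF G] .
  obtain I :: "'a \<Rightarrow> real set" where int: "\<And>i. i \<in> pverts G \<Longrightarrow> is_interval (I i)"
    and adj: "\<And>i j. i \<in> pverts G \<Longrightarrow> j \<in> pverts G \<Longrightarrow> i \<noteq> j \<Longrightarrow>
           ((i, j) \<in> parcs G \<longleftrightarrow> I i \<inter> I j \<noteq> {})"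
    using assms unfolding interval_graph_def by metis
  define U where "U i = {x. \<exists>y\<in>I i. y \<le> x}" for i
  have total: "U i \<subseteq> U j \<or> U j \<subset> U i" for i j
  proof (rule disjCI)
    assume "\<not> U j \<subset> U i"
    show "U i \<subseteq> U j"
    proof (rule ccontr)
      assume "\<not> U i \<subseteq> U j"
      then obtain x where x: "x \<in> U i" "x \<notin> U j" by blast
      have "U j \<subseteq> U i"
      proof
        fix y assume "y \<in> U j"
        then have "x \<le> y" using x(2) unfolding U_def using order_trans linear by blast
        then show "y \<in> U i" using x(1) unfolding U_def using order_trans by blast
      qed
      then show False using x \<open>\<not> U j \<subset> U i\<close> by blast
    qed
  qed
  \<comment> \<open>A chain of sets is sorted by a natural-number key: the number of strictly larger members.\<close>
  define f where "f i = card {j \<in> pverts G. U i \<subset> U j}" for i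
  have mono: "U v \<subseteq> U u" if "f u \<le> f v" "u \<in> pverts G" "v \<in> pverts G" for u v
  proof (rule ccontr)
    assume "\<not> U v \<subseteq> U u"
    then have "U u \<subset> U v" using total[of v u] by blast
    then have "{j \<in> pverts G. U v \<subset> U j} \<subset> {j \<in> pverts G. U u \<subset> U j}"
      using that(3) by blast
    then have "f v < f u" unfolding f_def by (intro psubset_card_mono) (use fin in auto)
    then show False using that by simp
  qed
  obtain ys where ys: "set ys = pverts G" "distinct ys"
    using fin finite_distinct_list by blast
  define xs where "xs = sort_key f ys"
  have xs: "set xs = pverts G" "distinct xs" "sorted (map f xs)"
    using ys by (auto simp: xs_def)
  then have len: "length xs = card (pverts G)" by (metis distinct_card)
  have "interval_ordering G (\<lambda>i. xs ! i)"
    unfolding interval_ordering_def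
  proof (intro conjI allI impI G)
    show "bij_betw ((!) xs) {..<card (pverts G)} (pverts G)"
      using bij_betw_nth[of xs] xs len by auto
  next
    fix i j k assume A: "i < j \<and> j < k \<and> k < card (pverts G) \<and> (xs ! i, xs ! k) \<in> parcs G"
    let ?u = "xs ! i" and ?v = "xs ! j" and ?w = "xs ! k"
    have V: "?u \<in> pverts G" "?v \<in> pverts G" "?w \<in> pverts G"
      using A xs len by (metis nth_mem order.strict_trans)+
    have "f ?u \<le> f ?v" "f ?v \<le> f ?w"
      using A xs(3) len by (auto simp: sorted_iff_nth_mono)
    then have UU: "U ?v \<subseteq> U ?u" "U ?w \<subseteq> U ?v" using mono V by auto
    have "?u \<noteq> ?w" "?u \<noteq> ?v" using A xs(2) len by (auto simp: nth_eq_iff_index_eq)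
    with A V adj obtain x where x: "x \<in> I ?u" "x \<in> I ?w" by blast
    then have "x \<in> U ?v" using UU unfolding U_def by blast
    then obtain y where y: "y \<in> I ?v" "y \<le> x" unfolding U_def by blast
    then have "y \<in> U ?u" using UU unfolding U_def by blast
    then obtain z where z: "z \<in> I ?u" "z \<le> y" unfolding U_def by blast
    have "y \<in> I ?u" using int[OF V(1)] z(1) x(1) z(2) y(2) unfolding is_interval_1 by blast
    then show "(?u, ?v) \<in> parcs G" using y(1) adj[OF V(1,2)] \<open>?u \<noteq> ?v\<close> by blast
  qed
  then show ?thesis using that by blast
qed

lemma finite_cliques: "finite (pverts G) \<Longrightarrow> finite {C. is_clique G C}"
  by (rule finite_subset[of _ "Pow (pverts G)"]) (auto simp: is_clique_def)

lemma clique_card_le: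
  assumes "finite (pverts G)" "is_clique G C"
  shows "card C \<le> clique_number G"
  unfolding clique_number_def using assms finite_cliques by (intro Max_ge) auto

lemma clique_number_attained:
  assumes "finite (pverts G)"
  obtains C where "is_clique G C" "card C = clique_number G"
proof -
  have "clique_number G \<in> card ` {C. is_clique G C}"
    unfolding clique_number_def
  proof (intro Max_in)
    show "finite (card ` {C. is_clique G C})" using finite_cliques[OF assms] by simp
    have "is_clique G {}" by (simp add: is_clique_def)
    then show "card ` {C. is_clique G C} \<noteq> {}" by blast
  qed
  then show ?thesis using that by auto
qed

definition earlier_nbrs :: "'a pair_pre_digraph \<Rightarrow> (nat \<Rightarrow> 'a) \<Rightarrow> nat \<Rightarrow> nat set" where
  "earlier_nbrs G e k = {i. i < k \<and> (e i, e k) \<in> parcs G}"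

lemma finite_earlier_nbrs [simp]: "finite (earlier_nbrs G e k)"
  by (simp add: earlier_nbrs_def)

text \<open>The earlier neighbours of \<open>k\<close> all reach the left end of \<open>k\<close>, so together with \<open>k\<close> they are a clique;
this is where the one-dimensional Helly property enters.\<close>

lemma card_earlier_nbrs:
  assumes e: "interval_ordering G e" and k: "k < card (pverts G)"
  shows "card (earlier_nbrs G e k) < clique_number G"
proof -
  let ?N = "insert k (earlier_nbrs G e k)"
  have G: "pair_graph G" and bij: "bij_betw e {..<card (pverts G)} (pverts G)"
    and trans: "\<And>i j k. i < j \<Longrightarrow> j < k \<Longrightarrow> k < card (pverts G) \<Longrightarrow> (e i, e k) \<in> parcs G \<Longrightarrow> (e i, e j) \<in> parcs G"
    using e unfolding interval_ordering_def by blast+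
  have sub: "?N \<subseteq> {..<card (pverts G)}" using k by (auto simp: earlier_nbrs_def)
  have lt: "(e i, e j) \<in> parcs G" if "i \<in> ?N" "j \<in> ?N" "i < j" for i j
    using that trans[of i j k] k by (auto simp: earlier_nbrs_def)
  have "is_clique G (e ` ?N)"
    unfolding is_clique_def
  proof (intro conjI ballI impI)
    show "e ` ?N \<subseteq> pverts G" using sub bij by (auto simp: bij_betw_def)
    fix u v assume "u \<in> e ` ?N" "v \<in> e ` ?N" "u \<noteq> v"
    then obtain i j where ij: "u = e i" "v = e j" "i \<in> ?N" "j \<in> ?N" "i \<noteq> j" by blast
    then show "(u, v) \<in> parcs G"
      using lt[of i j] lt[of j i] pair_graph_sym[OF G, of "e i" "e j"] by (cases "i < j") auto
  qed
  then have "card (e ` ?N) \<le> clique_number G"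
    using clique_card_le[OF pair_graph_finite[OF G]] by simp
  moreover have "card (e ` ?N) = card ?N"
    using bij sub by (intro card_image) (metis bij_betw_def inj_on_subset)
  moreover have "k \<notin> earlier_nbrs G e k" by (simp add: earlier_nbrs_def)
  ultimately show ?thesis by simp
qed

lemma greedy_colouring:
  fixes N :: "nat \<Rightarrow> nat set"
  assumes "\<And>k. k < n \<Longrightarrow> finite (N k) \<and> card (N k) < w"
  shows "\<exists>c :: nat \<Rightarrow> nat. \<forall>k<n. c k < w \<and> (\<forall>i\<in>N k. i < k \<longrightarrow> c i \<noteq> c k)"
  using assms
proof (induction n)
  case 0
  then show ?case by simp
next
  case (Suc n)
  then obtain c where c: "\<And>k. k < n \<Longrightarrow> c k < w \<and> (\<forall>i\<in>N k. i < k \<longrightarrow> c i \<noteq> c k)"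
    by (metis less_Suc_eq)
  have "card (c ` N n) < card {..<w}"
    using Suc.prems[of n] card_image_le[of "N n" c] by fastforce
  then obtain a where a: "a < w" "a \<notin> c ` N n"
    using Suc.prems[of n]
    by (metis card_mono finite_imageI leD lessThan_iff lessI subsetI)
  have "\<forall>k<Suc n. (c(n := a)) k < w \<and> (\<forall>i\<in>N k. i < k \<longrightarrow> (c(n := a)) i \<noteq> (c(n := a)) k)"
    using c a by (auto simp: less_Suc_eq)
  then show ?case by blast
qed

text \<open>Colouring greedily from left to right, a vertex is in conflict only with its earlier neighbours,
of which there are fewer than the clique number.\<close>

lemma interval_ordering_chromatic:
  assumes e: "interval_ordering G e"
  shows "chromatic_number G = clique_number G"
proof -
  let ?n = "card (pverts G)" and ?w = "clique_number G"
  have G: "pair_graph G" and bij: "bij_betw e {..<?n} (pverts G)"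
    using e unfolding interval_ordering_def by blast+
  obtain c :: "nat \<Rightarrow> nat" where c: "\<And>k. k < ?n \<Longrightarrow> c k < ?w"
      "\<And>k i. k < ?n \<Longrightarrow> i \<in> earlier_nbrs G e k \<Longrightarrow> c i \<noteq> c k"
    using greedy_colouring[of ?n "earlier_nbrs G e" ?w] card_earlier_nbrs[OF e]
    by (auto simp: earlier_nbrs_def)
  let ?g = "inv_into {..<?n} e"
  have g: "?g v < ?n" "e (?g v) = v" if "v \<in> pverts G" for v
    using that bij by (metis bij_betw_def inv_into_into lessThan_iff) (metis bij_betw_inv_into_right bij that)
  have "proper_colouring G ?w (c \<circ> ?g)"
    unfolding proper_colouring_def
  proof (intro conjI ballI, goal_cases)
    case (1 i)
    then show ?case using c g by simp
  next
    case (2 a)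
    obtain u v where a: "a = (u, v)" by force
    with 2 have uv: "(u, v) \<in> parcs G" "(v, u) \<in> parcs G" "u \<in> pverts G" "v \<in> pverts G" "u \<noteq> v"
      using pair_graph_arcs[OF G, of u v] by auto
    then have "?g u \<noteq> ?g v" using g by metis
    then have "?g u < ?g v \<and> ?g u \<in> earlier_nbrs G e (?g v) \<or> ?g v < ?g u \<and> ?g v \<in> earlier_nbrs G e (?g u)"
      using uv g by (auto simp: earlier_nbrs_def)
    then show ?case using c(2) g uv a by fastforce
  qed
  then have ex: "\<exists>c. proper_colouring G ?w c" by blast
  have "?w \<le> k" if "proper_colouring G k c" for k c
  proof -
    obtain C where C: "is_clique G C" "card C = ?w"
      using clique_number_attained[OF pair_graph_finite[OF G]] by blast
    have "inj_on c C"
      using C that unfolding is_clique_def proper_colouring_def inj_on_def by fast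
    moreover have "c ` C \<subseteq> {..<k}"
      using C that unfolding is_clique_def proper_colouring_def by auto
    ultimately show ?thesis using card_inj_on_le[of c C "{..<k}"] C by simp
  qed
  then show ?thesis
    unfolding chromatic_number_def using ex by (intro Least_equality) auto
qed

definition complete_graph :: "nat \<Rightarrow> nat pair_pre_digraph" where
  "complete_graph k = \<lparr>pverts = {..<k}, parcs = {(i, j). i < k \<and> j < k \<and> i \<noteq> j}\<rparr>"

lemma complete_graph_sel [simp]:
  "pverts (complete_graph k) = {..<k}"
  "parcs (complete_graph k) = {(i, j). i < k \<and> j < k \<and> i \<noteq> j}"
  by (simp_all add: complete_graph_def)

lemma pair_graph_complete_graph: "pair_graph (complete_graph k)"
proof -
  have "finite {(i, j). i < k \<and> j < k \<and> i \<noteq> j}"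
    by (rule finite_subset[of _ "{..<k} \<times> {..<k}"]) auto
  then show ?thesis
    by unfold_locales (auto simp: symmetric_def intro!: symI)
qed

text \<open>A homomorphic image of the complete graph has a rightmost vertex: there are \<open>Suc m\<close> choices for
its index and \<open>n\<close> for its place, and all other vertices are among its earlier neighbours.\<close>

lemma hom_density_complete_upper:
  assumes e: "interval_ordering G e" and n: "card (pverts G) > 0"
  shows "hom_density (complete_graph (Suc m)) G
    \<le> real (Suc m) * (real (clique_number G) / real (card (pverts G))) ^ m"
proof -
  let ?n = "card (pverts G)" and ?w = "clique_number G" and ?k = "Suc m"
  let ?N = "\<lambda>v. e ` earlier_nbrs G e v"
  let ?B = "\<lambda>i v. PiE {..<?k} (\<lambda>j. if j = i then {e v} else ?N v)"
  have G: "pair_graph G" and bij: "bij_betw e {..<?n} (pverts G)"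
    using e unfolding interval_ordering_def by blast+
  have fin: "finite (pverts G)" using pair_graph_finite[OF G] .
  have "graph_homs (complete_graph ?k) G \<subseteq> (\<Union>i<?k. \<Union>v<?n. ?B i v)"
  proof
    fix \<phi> assume \<phi>: "\<phi> \<in> graph_homs (complete_graph ?k) G"
    then have ext: "\<phi> \<in> {..<?k} \<rightarrow>\<^sub>E pverts G" and
      ad: "\<And>i j. i < ?k \<Longrightarrow> j < ?k \<Longrightarrow> i \<noteq> j \<Longrightarrow> (\<phi> i, \<phi> j) \<in> parcs G"
      by (auto simp: graph_homs_def)
    define g where "g i = inv_into {..<?n} e (\<phi> i)" for i
    have g: "g i < ?n" "e (g i) = \<phi> i" if "i < ?k" for i
    proof -
      have "\<phi> i \<in> e ` {..<?n}" using ext that bij by (auto simp: bij_betw_def)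
      then show "g i < ?n" "e (g i) = \<phi> i"
        unfolding g_def using inv_into_into[of "\<phi> i" e "{..<?n}"] f_inv_into_f[of "\<phi> i" e "{..<?n}"] by auto
    qed
    have "Max (g ` {..<?k}) \<in> g ` {..<?k}" by (intro Max_in) auto
    then obtain i where i: "i < ?k" "g i = Max (g ` {..<?k})" by auto
    have "g j \<in> earlier_nbrs G e (g i)" if "j < ?k" "j \<noteq> i" for j
    proof -
      have "g j \<le> g i" unfolding i(2) using that by (intro Max_ge) auto
      moreover have "g j \<noteq> g i" using ad[of j i] that i(1) g(2)[of i] g(2)[of j] pair_graph_arcs[OF G, of "\<phi> j" "\<phi> i"] by auto
      ultimately show ?thesis
        using ad[of j i] that i(1) g[of i] g[of j] unfolding earlier_nbrs_def by auto
    qed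
    then have "\<phi> j \<in> ?N (g i)" if "j < ?k" "j \<noteq> i" for j
      using that g by (metis imageI)
    moreover have "e (g i) = \<phi> i" using g i(1) by blast
    ultimately have "\<phi> \<in> ?B i (g i)" using ext by (intro PiE_I) (auto simp: PiE_iff extensional_def)
    moreover have "g i < ?n" using g i(1) by blast
    ultimately show "\<phi> \<in> (\<Union>i<?k. \<Union>v<?n. ?B i v)" using i(1)
      by (intro UN_I[of i] UN_I[of "g i"]) simp_all
  qed
  then have "card (graph_homs (complete_graph ?k) G) \<le> card (\<Union>i<?k. \<Union>v<?n. ?B i v)"
    by (intro card_mono finite_UN_I finite_PiE) simp_all
  also have "\<dots> \<le> (\<Sum>i<?k. card (\<Union>v<?n. ?B i v))" by (intro card_UN_le) auto
  also have "\<dots> \<le> (\<Sum>i<?k. \<Sum>v<?n. card (?B i v))" by (intro sum_mono card_UN_le) auto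
  also have "\<dots> \<le> (\<Sum>i<?k. \<Sum>v<?n. ?w ^ m)"
  proof (intro sum_mono)
    fix i v assume iv: "i \<in> {..<?k}" "v \<in> {..<?n}"
    have "card (?B i v) = (\<Prod>j<?k. card (if j = i then {e v} else ?N v))"
      by (simp add: card_PiE)
    also have "\<dots> = (\<Prod>j\<in>{..<?k}-{i}. card (?N v))"
      using iv by (subst prod.remove[of _ i]) auto
    also have "\<dots> = card (?N v) ^ m" using iv by simp
    also have "\<dots> \<le> ?w ^ m"
    proof (intro power_mono)
      have "card (?N v) \<le> card (earlier_nbrs G e v)" by (intro card_image_le) simp
      then show "card (?N v) \<le> ?w" using card_earlier_nbrs[OF e, of v] iv by simp
    qed simp
    finally show "card (?B i v) \<le> ?w ^ m" .
  qed
  also have "\<dots> = ?k * ?n * ?w ^ m" by (simp only: sum_constant card_lessThan mult.assoc of_nat_id)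
  finally have "real (card (graph_homs (complete_graph ?k) G)) \<le> real (?k * ?n * ?w ^ m)"
    using of_nat_le_iff by blast
  then have "hom_density (complete_graph ?k) G \<le> real (?k * ?n * ?w ^ m) / real ?n ^ ?k"
    unfolding hom_density_def by (simp add: card_PiE divide_right_mono del: of_nat_Suc)
  also have "\<dots> = real ?k * (real ?w / real ?n) ^ m"
    using n by (simp add: power_divide field_simps)
  finally show ?thesis .
qed

text \<open>Injections into a maximum clique are homomorphisms. Their number is a falling factorial of the
clique number \<open>w\<close>, and each of its \<open>k\<close> factors exceeds \<open>w - k\<close>.\<close>

lemma hom_density_complete_lower:
  assumes G: "pair_graph G" and k: "k \<le> clique_number G"
  shows "((real (clique_number G) - real k) / real (card (pverts G))) ^ k
    \<le> hom_density (complete_graph k) G"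
proof -
  let ?n = "card (pverts G)" and ?w = "clique_number G"
  have fin: "finite (pverts G)" using pair_graph_finite[OF G] .
  obtain C where C: "is_clique G C" "card C = ?w" using clique_number_attained[OF fin] .
  have finC: "finite C" using C fin by (auto simp: is_clique_def intro: finite_subset)
  let ?L = "{xs. length xs = k \<and> distinct xs \<and> set xs \<subseteq> C}"
  let ?h = "\<lambda>xs. restrict (nth xs) {..<k}"
  have "inj_on ?h ?L"
  proof (rule inj_onI)
    fix xs ys assume "xs \<in> ?L" "ys \<in> ?L" "?h xs = ?h ys"
    then have len: "length xs = k" "length ys = k" and eq: "?h xs = ?h ys" by auto
    have "xs ! i = ys ! i" if "i < k" for i
      using fun_cong[OF eq, of i] that by simp
    then show "xs = ys" using len by (intro nth_equalityI) auto
  qed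
  moreover have "?h ` ?L \<subseteq> graph_homs (complete_graph k) G"
  proof
    fix \<phi> assume "\<phi> \<in> ?h ` ?L"
    then obtain xs where xs: "\<phi> = ?h xs" "length xs = k" "distinct xs" "set xs \<subseteq> C" by blast
    have mem: "xs ! i \<in> C" if "i < k" for i using that xs by auto
    show "\<phi> \<in> graph_homs (complete_graph k) G"
      using xs mem C unfolding graph_homs_def is_clique_def
      by (auto simp: nth_eq_iff_index_eq)
  qed
  moreover have "finite (graph_homs (complete_graph k) G)"
    by (rule finite_subset[of _ "{..<k} \<rightarrow>\<^sub>E pverts G"]) (auto simp: graph_homs_def fin intro!: finite_PiE)
  ultimately have "card ?L \<le> card (graph_homs (complete_graph k) G)" by (rule card_inj_on_le)
  moreover have "card ?L = \<Prod>{?w - k + 1..?w}"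
    using card_lists_distinct_length_eq[OF finC] C k by simp
  moreover have "(?w - k) ^ k \<le> \<Prod>{?w - k + 1..?w}"
  proof -
    have "(\<Prod>i\<in>{?w - k + 1..?w}. ?w - k) \<le> \<Prod>{?w - k + 1..?w}" by (intro prod_mono) auto
    then show ?thesis using k by simp
  qed
  ultimately have "real ((?w - k) ^ k) \<le> real (card (graph_homs (complete_graph k) G))"
    using of_nat_le_iff order_trans by metis
  then have "(real ?w - real k) ^ k \<le> real (card (graph_homs (complete_graph k) G))"
    using k by (simp add: of_nat_diff)
  then show "((real ?w - real k) / real ?n) ^ k \<le> hom_density (complete_graph k) G"
    unfolding hom_density_def by (simp add: card_PiE power_divide divide_right_mono)
qed

text \<open>The right end of vertex \<open>i\<close>, whose left end is placed at \<open>i\<close>. The vertex itself is included, which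
keeps the interval non-empty when there is no later neighbour.\<close>

definition last_nbr :: "'a pair_pre_digraph \<Rightarrow> (nat \<Rightarrow> 'a) \<Rightarrow> nat \<Rightarrow> nat" where
  "last_nbr G e i = Max (insert i {j. j < card (pverts G) \<and> (e i, e j) \<in> parcs G})"

lemma last_nbr_bounds:
  assumes "i < card (pverts G)"
  shows "i \<le> last_nbr G e i" "last_nbr G e i < card (pverts G)"
  using assms unfolding last_nbr_def by (auto simp: Max_ge)

lemma interval_ordering_adj:
  assumes e: "interval_ordering G e" and ij: "i < card (pverts G)" "j < card (pverts G)"
  shows "(e i, e j) \<in> parcs G \<longleftrightarrow> i \<noteq> j \<and> i \<le> last_nbr G e j \<and> j \<le> last_nbr G e i"
proof -
  have G: "pair_graph G" 
    and trans: "\<And>i j k. i < j \<Longrightarrow> j < k \<Longrightarrow> k < card (pverts G) \<Longrightarrow> (e i, e k) \<in> parcs G \<Longrightarrow> (e i, e j) \<in> parcs G"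
    using e unfolding interval_ordering_def by blast+
  have main: "(e i, e j) \<in> parcs G \<longleftrightarrow> j \<le> last_nbr G e i"
    if ij: "i < j" "j < card (pverts G)" for i j
  proof
    assume "(e i, e j) \<in> parcs G"
    then show "j \<le> last_nbr G e i" unfolding last_nbr_def using ij by (intro Max_ge) auto
  next
    assume le: "j \<le> last_nbr G e i"
    have "last_nbr G e i \<in> insert i {j. j < card (pverts G) \<and> (e i, e j) \<in> parcs G}"
      unfolding last_nbr_def by (intro Max_in) auto
    with le ij have "last_nbr G e i < card (pverts G)" "(e i, e (last_nbr G e i)) \<in> parcs G" by auto
    then show "(e i, e j) \<in> parcs G" using trans[of i j "last_nbr G e i"] le ij
      by (cases "j = last_nbr G e i") auto
  qed
  consider "i < j" | "j < i" | "i = j" by linarith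
  then show ?thesis
  proof cases
    case 1
    then show ?thesis using main[OF 1] ij last_nbr_bounds(1)[of j G e] by auto
  next
    case 2
    then show ?thesis using main[OF 2] ij last_nbr_bounds(1)[of i G e] pair_graph_sym[OF G, of "e i" "e j"] by auto
  next
    case 3
    then show ?thesis using pair_graph_arcs[OF G, of "e i" "e j"] by fastforce
  qed
qed

section \<open>A continuous curve through all intervals\<close>

text \<open>A continuous function of period \<open>2\<close> that is \<open>0\<close> on \<open>[0, 1/3]\<close> and \<open>1\<close> on \<open>[2/3, 1]\<close>. On a number
in \<open>[0, 1]\<close> whose ternary digits are \<open>0\<close> and \<open>2\<close>, it therefore reads off half of the first digit.\<close>

definition bump :: "real \<Rightarrow> real" where
  "bump t = min 1 (max 0 (1 / 2 - cos (pi * t)))"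

lemma bump_bounds: "0 \<le> bump t" "bump t \<le> 1"
  by (auto simp: bump_def)

lemma continuous_on_bump: "continuous_on A bump"
  unfolding bump_def by (intro continuous_intros)

lemma bump_periodic: "bump (2 * real m + t) = bump t"
proof -
  have "cos (pi * (2 * real m + t)) = cos (2 * real m * pi + pi * t)" by (simp add: algebra_simps)
  also have "\<dots> = cos (pi * t)" by (simp only: cos_add cos_2npi sin_2npi mult_1_left mult_zero_left diff_zero)
  finally show ?thesis by (simp add: bump_def)
qed

lemma bump_low: "0 \<le> t \<Longrightarrow> t \<le> 1 / 3 \<Longrightarrow> bump t = 0"
proof -
  assume t: "0 \<le> t" "t \<le> 1 / 3"
  have "cos (pi / 3) \<le> cos (pi * t)"
    using t by (intro cos_monotone_0_pi_le) (auto simp: field_simps)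
  then show ?thesis by (simp add: bump_def cos_60)
qed

lemma bump_high: "2 / 3 \<le> t \<Longrightarrow> t \<le> 1 \<Longrightarrow> bump t = 1"
proof -
  assume t: "2 / 3 \<le> t" "t \<le> 1"
  have "pi * t \<le> pi * 1" using t by (intro mult_left_mono) auto
  then have "cos (pi * t) \<le> cos (2 / 3 * pi)"
    using t by (intro cos_monotone_0_pi_le) (auto simp: field_simps)
  then show ?thesis by (simp add: bump_def cos_120)
qed

text \<open>The coordinates of Schoenberg's space-filling curve: for \<open>s = 0\<close> and \<open>s = 1\<close> the even-placed and
the odd-placed ternary digits of \<open>t\<close> are turned into the binary digits of a coordinate.\<close>

definition schoenberg :: "nat \<Rightarrow> real \<Rightarrow> real" where
  "schoenberg s t = (\<Sum>k. bump (3 ^ (2 * k + s) * t) / 2 ^ Suc k)"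

lemma half_powers_sums: "(\<lambda>k. 1 / 2 ^ Suc k :: real) sums 1"
  using power_half_series by (simp add: power_one_over)

lemma summable_schoenberg: "summable (\<lambda>k. bump (3 ^ (2 * k + s) * t) / 2 ^ Suc k)"
  by (rule summable_comparison_test'[OF sums_summable[OF half_powers_sums], of 0])
     (auto simp: divide_right_mono bump_bounds abs_of_nonneg)

lemma schoenberg_bounds: "0 \<le> schoenberg s t" "schoenberg s t \<le> 1"
proof -
  show "0 \<le> schoenberg s t"
    unfolding schoenberg_def by (intro suminf_nonneg summable_schoenberg) (simp add: bump_bounds)
  have "schoenberg s t \<le> (\<Sum>k. 1 / 2 ^ Suc k)"
    unfolding schoenberg_def
    by (intro suminf_le summable_schoenberg sums_summable[OF half_powers_sums])
       (simp add: divide_right_mono bump_bounds)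
  then show "schoenberg s t \<le> 1" using sums_unique[OF half_powers_sums] by simp
qed

lemma continuous_on_schoenberg: "continuous_on UNIV (schoenberg s)"
proof -
  have "uniform_limit UNIV (\<lambda>n t. \<Sum>k<n. bump (3 ^ (2 * k + s) * t) / 2 ^ Suc k)
      (\<lambda>t. \<Sum>k. bump (3 ^ (2 * k + s) * t) / 2 ^ Suc k) sequentially"
    by (rule Weierstrass_m_test[OF _ sums_summable[OF half_powers_sums]])
       (auto simp: divide_right_mono bump_bounds abs_of_nonneg)
  then have "continuous_on UNIV (\<lambda>t. \<Sum>k. bump (3 ^ (2 * k + s) * t) / 2 ^ Suc k)"
    by (rule uniform_limit_theorem[rotated])
       (auto intro!: always_eventually continuous_intros continuous_on_compose2[OF continuous_on_bump[of UNIV]])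
  then show ?thesis unfolding schoenberg_def by simp
qed

lemma binary_expansion:
  fixes x :: real
  assumes "0 \<le> x" "x \<le> 1"
  obtains a :: "nat \<Rightarrow> real" where "\<And>k. a k \<in> {0, 1}" "(\<lambda>k. a k / 2 ^ Suc k) sums x"
proof -
  \<comment> \<open>The digits are the itinerary of x under the doubling map; the map keeps 1 fixed,
    so that x = 1 gets the digits 1, 1, 1, ...\<close>
  define d :: "real \<Rightarrow> real" where "d y = (if y \<ge> 1 / 2 then 1 else 0)" for y
  define X where "X k = ((\<lambda>y. 2 * y - d y) ^^ k) x" for k
  define a where "a k = d (X k)" for k
  have X: "0 \<le> X k \<and> X k \<le> 1" for k
    by (induction k) (use assms in \<open>auto simp: X_def d_def\<close>)
  have part: "x - (\<Sum>k<n. a k / 2 ^ Suc k) = X n / 2 ^ n" for n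
  proof (induction n)
    case 0
    then show ?case by (simp add: X_def)
  next
    case (Suc n)
    have "X (Suc n) = 2 * X n - a n" by (simp add: X_def a_def)
    then show ?case using Suc by (simp add: field_simps)
  qed
  have "(\<lambda>n. X n / 2 ^ n) \<longlonglongrightarrow> 0"
  proof (rule Lim_null_comparison)
    show "\<forall>\<^sub>F n in sequentially. norm (X n / 2 ^ n) \<le> (1 / 2) ^ n"
      using X by (auto simp: power_one_over divide_right_mono abs_of_nonneg intro!: always_eventually)
    show "(\<lambda>n. (1 / 2 :: real) ^ n) \<longlonglongrightarrow> 0" by (rule LIMSEQ_power_zero) simp
  qed
  then have "(\<lambda>n. x - (x - (\<Sum>k<n. a k / 2 ^ Suc k))) \<longlonglongrightarrow> x - 0"
    unfolding part by (intro tendsto_intros)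
  then have "(\<lambda>k. a k / 2 ^ Suc k) sums x" by (simp add: sums_def)
  moreover have "a k \<in> {0, 1}" for k by (simp add: a_def d_def)
  ultimately show ?thesis using that by blast
qed

text \<open>The witness is \<open>t = \<Sum>j. 2 * c j / 3 ^ (j + 1)\<close>. Multiplication by \<open>3 ^ k\<close> shifts the digits: the
part before the point is an even integer, which the periodicity of the bump removes, and the
remaining part starts with the digit \<open>2 * c k\<close>.\<close>

lemma bump_reads_digit:
  fixes c :: "nat \<Rightarrow> real"
  assumes c: "\<And>k. c k \<in> {0, 1}"
  obtains t where "0 \<le> t" "t \<le> 1" "\<And>k. bump (3 ^ k * t) = c k"
proof -
  define T where "T k = (\<Sum>j. 2 * c (k + j) / 3 ^ Suc j)" for k
  have third: "(\<lambda>j. 2 / 3 ^ Suc j :: real) sums 1"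
    using sums_mult[OF geometric_sums[of "1 / 3 :: real"], of "2 / 3"]
    by (simp add: power_one_over field_simps)
  have c01: "0 \<le> c k" "c k \<le> 1" for k using c[of k] by auto
  have le: "2 * c (k + j) / 3 ^ Suc j \<le> 2 / 3 ^ Suc j" for k j
    using c01 by (intro divide_right_mono) auto
  have summ: "summable (\<lambda>j. 2 * c (k + j) / 3 ^ Suc j)" for k
    by (rule summable_comparison_test'[OF sums_summable[OF third], of 0])
       (use le c01 in \<open>auto simp: abs_of_nonneg\<close>)
  have T: "0 \<le> T k" "T k \<le> 1" for k
  proof -
    show "0 \<le> T k" unfolding T_def using c01 by (intro suminf_nonneg summ) auto
    have "T k \<le> (\<Sum>j. 2 / 3 ^ Suc j)" unfolding T_def
      by (intro suminf_le summ sums_summable[OF third] le)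
    then show "T k \<le> 1" using sums_unique[OF third] by simp
  qed
  have step: "T k = 2 * c k / 3 + T (Suc k) / 3" for k
  proof -
    have "T k = 2 * c k / 3 + (\<Sum>j. 2 * c (k + Suc j) / 3 ^ Suc (Suc j))"
      unfolding T_def using suminf_split_head[OF summ[of k]] by simp
    also have "(\<Sum>j. 2 * c (k + Suc j) / 3 ^ Suc (Suc j)) = (\<Sum>j. 2 * c (Suc k + j) / 3 ^ Suc j / 3)"
      by (intro arg_cong[where f = suminf] ext) (simp add: field_simps)
    also have "\<dots> = T (Suc k) / 3"
      unfolding T_def by (rule suminf_divide[OF summ[of "Suc k"]])
    finally show ?thesis .
  qed
  have shift: "\<exists>m. 3 ^ k * T 0 = 2 * real m + T k" for k
  proof (induction k)
    case 0
    then show ?case by (intro exI[of _ 0]) simp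
  next
    case (Suc k)
    then obtain m where m: "3 ^ k * T 0 = 2 * real m + T k" by blast
    have "c k = real (nat \<lfloor>c k\<rfloor>)" using c[of k] by auto
    then have "3 ^ Suc k * T 0 = 2 * real (3 * m + nat \<lfloor>c k\<rfloor>) + T (Suc k)"
      using m step[of k] by (simp add: algebra_simps)
    then show ?case by blast
  qed
  have "bump (3 ^ k * T 0) = c k" for k
  proof -
    obtain m where "3 ^ k * T 0 = 2 * real m + T k" using shift by blast
    then have "bump (3 ^ k * T 0) = bump (T k)" by (simp add: bump_periodic)
    also have "\<dots> = c k"
      using c[of k] step[of k] T[of k] T[of "Suc k"] by (auto intro!: bump_low bump_high)
    finally show ?thesis .
  qed
  then show ?thesis using that T by blast
qed

lemma schoenberg_onto:
  assumes "0 \<le> x" "x \<le> 1" "0 \<le> y" "y \<le> 1"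
  obtains t where "0 \<le> t" "t \<le> 1" "schoenberg 0 t = x" "schoenberg 1 t = y"
proof -
  obtain a where a: "\<And>k. a k \<in> {0, 1 :: real}" "(\<lambda>k. a k / 2 ^ Suc k) sums x"
    using binary_expansion[OF assms(1,2)] by blast
  obtain b where b: "\<And>k. b k \<in> {0, 1 :: real}" "(\<lambda>k. b k / 2 ^ Suc k) sums y"
    using binary_expansion[OF assms(3,4)] by blast
  define c where "c k = (if even k then a (k div 2) else b (k div 2))" for k
  have "c k \<in> {0, 1}" for k using a(1) b(1) by (simp add: c_def)
  then obtain t where t: "0 \<le> t" "t \<le> 1" "\<And>k. bump (3 ^ k * t) = c k"
    using bump_reads_digit by blast
  have "schoenberg 0 t = x" "schoenberg 1 t = y"
    using sums_unique[OF a(2)] sums_unique[OF b(2)] unfolding schoenberg_def t(3)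
    by (simp_all add: c_def)
  then show ?thesis using that t by blast
qed

text \<open>Taking minimum and maximum of the coordinates folds the square onto the triangle. The curve turns
random intervals into random reals without losing continuity, and so makes the one-dimensional
theorems on weak convergence applicable to measures on \<open>\<S>\<close>.\<close>

lemma segment_curve:
  obtains \<psi> :: "real \<Rightarrow> real \<times> real"
  where "continuous_on UNIV \<psi>" "\<And>t. \<psi> t \<in> \<S>" "\<And>p. p \<in> \<S> \<Longrightarrow> \<exists>t. 0 \<le> t \<and> t \<le> 1 \<and> \<psi> t = p"
proof
  let ?\<psi> = "\<lambda>t. (min (schoenberg 0 t) (schoenberg 1 t), max (schoenberg 0 t) (schoenberg 1 t))"
  show "continuous_on UNIV ?\<psi>"
    by (intro continuous_intros continuous_on_schoenberg)
  show "?\<psi> t \<in> \<S>" for t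
    using schoenberg_bounds[of 0 t] schoenberg_bounds[of 1 t] by (auto simp: \<S>_def)
  fix p assume "p \<in> \<S>"
  then have "0 \<le> fst p" "fst p \<le> 1" "0 \<le> snd p" "snd p \<le> 1" "fst p \<le> snd p"
    by (auto simp: \<S>_def)
  then show "\<exists>t. 0 \<le> t \<and> t \<le> 1 \<and> ?\<psi> t = p"
    using schoenberg_onto[of "fst p" "snd p"] by (metis max.absorb2 min.absorb1 prod.collapse)
qed

section \<open>Cliques in measures on intervals\<close>

lemma W_eq: "W I J = (if max (fst I) (fst J) \<le> min (snd I) (snd J) then 1 else 0)"
  by (auto simp: W_def Int_atLeastAtMost)

lemma W_sym: "W I J = W J I"
  by (simp add: W_eq max.commute min.commute)

lemma W_eq_1_iff:
  "I \<in> \<S> \<Longrightarrow> J \<in> \<S> \<Longrightarrow> W I J = 1 \<longleftrightarrow> fst I \<le> snd J \<and> fst J \<le> snd I"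
  by (auto simp: W_eq \<S>_def)

lemma space_PS: "\<mu> \<in> \<P>\<S> \<Longrightarrow> space \<mu> = \<S>"
  using sets_eq_imp_space_eq[of \<mu> "restrict_space borel \<S>"]
  by (simp add: \<P>\<S>_def space_restrict_space)

lemma PS_measurable:
  assumes "\<mu> \<in> \<P>\<S>"
  shows "fst \<in> borel_measurable \<mu>" "snd \<in> borel_measurable \<mu>"
proof -
  have "sets \<mu> = sets (restrict_space borel \<S>)" using assms by (simp add: \<P>\<S>_def)
  moreover have "fst \<in> borel_measurable (restrict_space (borel :: (real \<times> real) measure) \<S>)"
    "snd \<in> borel_measurable (restrict_space (borel :: (real \<times> real) measure) \<S>)"
    by (auto intro!: measurable_restrict_space1 borel_measurable_continuous_onI continuous_intros)
  ultimately show "fst \<in> borel_measurable \<mu>" "snd \<in> borel_measurable \<mu>"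
    by (simp_all cong: measurable_cong_sets)
qed

lemma W_event_measurable:
  fixes F :: "nat pair_pre_digraph" and X :: "'b \<Rightarrow> real \<times> real"
  assumes F: "pair_graph F"
    and [measurable]: "(\<lambda>\<omega>. fst (X \<omega>)) \<in> borel_measurable M" "(\<lambda>\<omega>. snd (X \<omega>)) \<in> borel_measurable M"
  shows "{\<omega> \<in> space (\<Pi>\<^sub>M i\<in>pverts F. M). \<forall>(i, j)\<in>parcs F. W (X (\<omega> i)) (X (\<omega> j)) = 1}
    \<in> sets (\<Pi>\<^sub>M i\<in>pverts F. M)"
proof -
  have fin: "finite (parcs F)" using pair_graph_finite_arcs[OF F] .
  have "{\<omega> \<in> space (\<Pi>\<^sub>M i\<in>pverts F. M). W (X (\<omega> (fst a))) (X (\<omega> (snd a))) = 1}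
      \<in> sets (\<Pi>\<^sub>M i\<in>pverts F. M)" if "a \<in> parcs F" for a
  proof -
    have [measurable]: "fst a \<in> pverts F" "snd a \<in> pverts F"
      using that pair_graph_arcs[OF F, of "fst a" "snd a"] by auto
    show ?thesis unfolding W_eq by measurable
  qed
  then have "{\<omega> \<in> space (\<Pi>\<^sub>M i\<in>pverts F. M). \<forall>a\<in>parcs F. W (X (\<omega> (fst a))) (X (\<omega> (snd a))) = 1}
    \<in> sets (\<Pi>\<^sub>M i\<in>pverts F. M)"
    by (intro sets.sets_Collect_finite_All fin)
  then show ?thesis by (simp add: case_prod_unfold)
qed

text \<open>The product takes each edge once and the event takes each arc; they agree because \<open>W\<close> is
symmetric with values in \<open>{0, 1}\<close>.\<close>

lemma measure_density_eq_prob: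
  assumes F: "pair_graph F" and \<mu>: "\<mu> \<in> \<P>\<S>"
  shows "measure_density F \<mu> = measure (\<Pi>\<^sub>M i\<in>pverts F. \<mu>)
    {x \<in> space (\<Pi>\<^sub>M i\<in>pverts F. \<mu>). \<forall>(i, j)\<in>parcs F. W (x i) (x j) = 1}"
proof -
  let ?E = "{x \<in> space (\<Pi>\<^sub>M i\<in>pverts F. \<mu>). \<forall>(i, j)\<in>parcs F. W (x i) (x j) = 1}"
  have fin: "finite (parcs F)" using pair_graph_finite_arcs[OF F] .
  have prod: "(\<Prod>(i, j)\<in>{(i, j)\<in>parcs F. i < j}. W (x i) (x j)) = (indicator ?E x :: real)"
    if x: "x \<in> space (\<Pi>\<^sub>M i\<in>pverts F. \<mu>)" for x
  proof (cases "x \<in> ?E")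
    case True
    then have "(\<Prod>(i, j)\<in>{(i, j)\<in>parcs F. i < j}. W (x i) (x j)) = 1"
      by (intro prod.neutral) auto
    then show ?thesis using True by simp
  next
    case False
    then obtain i j where ij: "(i, j) \<in> parcs F" "W (x i) (x j) \<noteq> 1" using x by blast
    have "\<exists>i j. (i, j) \<in> parcs F \<and> i < j \<and> W (x i) (x j) = 0"
    proof (cases "i < j")
      case True
      then show ?thesis using ij by (metis W_eq)
    next
      case False
      then have "j < i" "(j, i) \<in> parcs F" using pair_graph_arcs[OF F ij(1)] by auto
      moreover have "W (x j) (x i) = 0" using ij(2) by (metis W_eq W_sym)
      ultimately show ?thesis by blast
    qed
    then obtain i j where "(i, j) \<in> parcs F" "i < j" "W (x i) (x j) = 0" by blast
    then have "(\<Prod>(i, j)\<in>{(i, j)\<in>parcs F. i < j}. W (x i) (x j)) = 0"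
      using finite_subset[OF _ fin, of "{(i, j)\<in>parcs F. i < j}"]
      by (subst prod_zero_iff) (auto intro!: bexI[of _ "(i, j)"])
    then show ?thesis using False by simp
  qed
  have "measure_density F \<mu> = (\<integral>x. indicator ?E x \<partial>(\<Pi>\<^sub>M i\<in>pverts F. \<mu>))"
    unfolding measure_density_def by (intro Bochner_Integration.integral_cong refl prod)
  also have "\<dots> = measure (\<Pi>\<^sub>M i\<in>pverts F. \<mu>) (?E \<inter> space (\<Pi>\<^sub>M i\<in>pverts F. \<mu>))"
    by (rule Bochner_Integration.integral_indicator)
  also have "?E \<inter> space (\<Pi>\<^sub>M i\<in>pverts F. \<mu>) = ?E" by blast
  finally show ?thesis .
qed

lemma finite_product_prob_space_const:
  assumes "prob_space M" "finite I"
  shows "finite_product_prob_space (\<lambda>_. M) I"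
proof -
  interpret prob_space M by fact
  show ?thesis using assms(2) by unfold_locales
qed

definition intervals_through :: "real \<Rightarrow> (real \<times> real) set" where
  "intervals_through a = {I \<in> \<S>. a \<in> {fst I..snd I}}"

lemma intervals_through_sets:
  assumes \<mu>: "\<mu> \<in> \<P>\<S>"
  shows "intervals_through a \<in> sets \<mu>"
proof -
  note [measurable] = PS_measurable[OF \<mu>]
  have "{I \<in> space \<mu>. fst I \<le> a \<and> a \<le> snd I} \<in> sets \<mu>" by measurable
  then show ?thesis by (simp add: intervals_through_def space_PS[OF \<mu>])
qed

lemma intervals_through_le_measure_clique_number:
  assumes \<mu>: "\<mu> \<in> \<P>\<S>" and a: "0 \<le> a" "a \<le> 1"
  shows "measure \<mu> (intervals_through a) \<le> measure_clique_number \<mu>"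
proof -
  interpret prob_space \<mu> using \<mu> by (simp add: \<P>\<S>_def)
  show ?thesis
    unfolding measure_clique_number_def intervals_through_def[symmetric] using a
    by (intro cSUP_upper bdd_aboveI[of _ 1]) auto
qed

lemma measure_clique_number_bounds:
  assumes \<mu>: "\<mu> \<in> \<P>\<S>"
  shows "0 \<le> measure_clique_number \<mu>" "measure_clique_number \<mu> \<le> 1"
proof -
  interpret prob_space \<mu> using \<mu> by (simp add: \<P>\<S>_def)
  show "0 \<le> measure_clique_number \<mu>"
    using intervals_through_le_measure_clique_number[OF \<mu>, of 0] by (rule order_trans[OF measure_nonneg]) auto
  show "measure_clique_number \<mu> \<le> 1"
    unfolding measure_clique_number_def by (intro cSUP_least) auto
qed

text \<open>Intervals that all contain the point \<open>a\<close> meet pairwise, so each \<open>\<mu>\<close>-mass of intervals through a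
point, raised to the power \<open>Suc m\<close>, is a lower bound. Taking roots passes this on to the supremum.\<close>

lemma measure_density_complete_lower:
  assumes \<mu>: "\<mu> \<in> \<P>\<S>"
  shows "measure_clique_number \<mu> ^ Suc m \<le> measure_density (complete_graph (Suc m)) \<mu>"
proof -
  let ?k = "Suc m"
  let ?D = "measure_density (complete_graph ?k) \<mu>"
  let ?P = "\<Pi>\<^sub>M i\<in>{..<?k}. \<mu>"
  interpret prob_space \<mu> using \<mu> by (simp add: \<P>\<S>_def)
  interpret P: finite_product_prob_space "\<lambda>_. \<mu>" "{..<?k}"
    by (rule finite_product_prob_space_const) (auto intro: prob_space_axioms)
  let ?E = "{x \<in> space ?P. \<forall>(i, j)\<in>parcs (complete_graph ?k). W (x i) (x j) = 1}"
  have D: "?D = measure ?P ?E"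
    using measure_density_eq_prob[OF pair_graph_complete_graph \<mu>, of ?k]
    unfolding complete_graph_sel(1) .
  have le: "measure \<mu> (intervals_through a) ^ ?k \<le> ?D" for a
  proof -
    have "measure \<mu> (intervals_through a) ^ ?k = measure ?P (PiE {..<?k} (\<lambda>_. intervals_through a))"
      using P.prob_times[of "\<lambda>_. intervals_through a"] intervals_through_sets[OF \<mu>] by simp
    also have "\<dots> \<le> measure ?P ?E"
    proof (rule P.finite_measure_mono)
      show "PiE {..<?k} (\<lambda>_. intervals_through a) \<subseteq> ?E"
      proof
        fix x assume x: "x \<in> PiE {..<?k} (\<lambda>_. intervals_through a)"
        then have "x \<in> space ?P" by (auto simp: space_PiM space_PS[OF \<mu>] PiE_iff intervals_through_def)
        moreover have "W (x i) (x j) = 1" if "i < ?k" "j < ?k" for i j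
        proof -
          have "x i \<in> intervals_through a" "x j \<in> intervals_through a" using x that by auto
          then show ?thesis by (auto simp: W_eq_1_iff intervals_through_def)
        qed
        ultimately show "x \<in> ?E" by auto
      qed
      show "?E \<in> sets ?P"
        by (rule W_event_measurable[OF pair_graph_complete_graph[of ?k], of "\<lambda>x. x" \<mu>,
              unfolded complete_graph_sel(1)]) (rule PS_measurable[OF \<mu>])+
    qed
    finally show ?thesis using D by simp
  qed
  then have "measure \<mu> (intervals_through a) \<le> root ?k ?D" for a
    using real_root_le_mono[OF _ le[of a], of ?k]
    by (simp add: real_root_power_cancel del: power_Suc)
  then have "measure_clique_number \<mu> \<le> root ?k ?D"
    unfolding measure_clique_number_def intervals_through_def[symmetric] by (intro cSUP_least) auto
  then have "measure_clique_number \<mu> ^ ?k \<le> root ?k ?D ^ ?k"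
    by (intro power_mono measure_clique_number_bounds \<mu>)
  also have "\<dots> = ?D" using D by (intro real_root_pow_pos2) auto
  finally show ?thesis .
qed

text \<open>The continuous version of the finite upper bound. Among pairwise intersecting intervals, one has
the largest left endpoint, and all the others contain that point. Conditionally on this interval,
the probability of the latter is at most the \<open>m\<close>-th power of the clique number.\<close>

lemma measure_density_complete_upper:
  assumes \<mu>: "\<mu> \<in> \<P>\<S>"
  shows "measure_density (complete_graph (Suc m)) \<mu> \<le> real (Suc m) * measure_clique_number \<mu> ^ m"
proof -
  let ?k = "Suc m" and ?w = "measure_clique_number \<mu>"
  let ?P = "\<Pi>\<^sub>M i\<in>{..<?k}. \<mu>"
  interpret prob_space \<mu> using \<mu> by (simp add: \<P>\<S>_def)
  interpret P: finite_product_prob_space "\<lambda>_. \<mu>" "{..<?k}"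
    by (rule finite_product_prob_space_const) (auto intro: prob_space_axioms)
  note [measurable] = PS_measurable[OF \<mu>]
  let ?E = "{x \<in> space ?P. \<forall>(i, j)\<in>parcs (complete_graph ?k). W (x i) (x j) = 1}"
  let ?B = "\<lambda>i. {x \<in> space ?P. \<forall>j\<in>{..<?k} - {i}. fst (x j) \<le> fst (x i) \<and> fst (x i) \<le> snd (x j)}"
  have B_sets: "?B i \<in> sets ?P" if i: "i \<in> {..<?k}" for i
  proof (intro sets.sets_Collect_finite_All)
    fix j assume "j \<in> {..<?k} - {i}"
    then have j: "j \<in> {..<?k}" by simp
    note m =
      measurable_compose[OF measurable_component_singleton[OF i] PS_measurable(1)[OF \<mu>]]
      measurable_compose[OF measurable_component_singleton[OF j] PS_measurable(1)[OF \<mu>]]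
      measurable_compose[OF measurable_component_singleton[OF j] PS_measurable(2)[OF \<mu>]]
    show "{x \<in> space ?P. fst (x j) \<le> fst (x i) \<and> fst (x i) \<le> snd (x j)} \<in> sets ?P"
      by (intro sets.sets_Collect_conj borel_measurable_le m)
  qed simp
  have "?E \<subseteq> (\<Union>i<?k. ?B i)"
  proof
    fix x assume x: "x \<in> ?E"
    then have S: "x i \<in> \<S>" if "i < ?k" for i using that by (auto simp: space_PiM space_PS[OF \<mu>] PiE_iff)
    let ?L = "(\<lambda>i. fst (x i)) ` {..<?k}"
    have "Max ?L \<in> ?L" by (intro Max_in) auto
    then obtain i where i: "i < ?k" "fst (x i) = Max ?L" by auto
    have "fst (x j) \<le> fst (x i) \<and> fst (x i) \<le> snd (x j)" if j: "j \<in> {..<?k} - {i}" for j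
    proof -
      have "fst (x j) \<le> fst (x i)" unfolding i(2) using j by (intro Max_ge) auto
      moreover have "W (x i) (x j) = 1" using x i(1) j by auto
      then have "fst (x i) \<le> snd (x j)" using S[OF i(1)] S[of j] j by (simp add: W_eq_1_iff)
      ultimately show ?thesis by simp
    qed
    then show "x \<in> (\<Union>i<?k. ?B i)" using i(1) x by blast
  qed
  then have "measure ?P ?E \<le> measure ?P (\<Union>i<?k. ?B i)"
    using B_sets by (intro P.finite_measure_mono sets.finite_UN) auto
  also have "\<dots> \<le> (\<Sum>i<?k. measure ?P (?B i))"
    using B_sets by (intro P.finite_measure_subadditive_finite) auto
  also have "\<dots> \<le> (\<Sum>i<?k. ?w ^ m)"
  proof (intro sum_mono)
    fix i assume i: "i \<in> {..<?k}"
    \<comment> \<open>Fubini: integrate over the other intervals first, with interval i fixed to be y.\<close>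
    let ?I = "{..<?k} - {i}"
    let ?Q = "\<Pi>\<^sub>M i\<in>?I. \<mu>"
    interpret Q: finite_product_prob_space "\<lambda>_. \<mu>" ?I
      by (rule finite_product_prob_space_const) (auto intro: prob_space_axioms)
    have ins: "insert i ?I = {..<?k}" using i by auto
    have meas: "indicator (?B i) \<in> borel_measurable (\<Pi>\<^sub>M i\<in>insert i ?I. \<mu>)"
      unfolding ins using B_sets[OF i] by (rule borel_measurable_indicator)
    have "emeasure ?P (?B i) = (\<integral>\<^sup>+x. indicator (?B i) x \<partial>(\<Pi>\<^sub>M i\<in>insert i ?I. \<mu>))"
      unfolding ins using B_sets[OF i] by simp
    also have "\<dots> = (\<integral>\<^sup>+y. (\<integral>\<^sup>+x. indicator (?B i) (x(i := y)) \<partial>?Q) \<partial>\<mu>)"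
      by (rule P.product_nn_integral_insert_rev[OF _ _ meas]) auto
    also have "\<dots> \<le> (\<integral>\<^sup>+y. ennreal (?w ^ m) \<partial>\<mu>)"
    proof (rule nn_integral_mono)
      fix y assume y: "y \<in> space \<mu>"
      have yS: "y \<in> \<S>" using y space_PS[OF \<mu>] by simp
      have "(\<integral>\<^sup>+x. indicator (?B i) (x(i := y)) \<partial>?Q) \<le> (\<integral>\<^sup>+x. indicator (PiE ?I (\<lambda>_. intervals_through (fst y))) x \<partial>?Q)"
      proof (rule nn_integral_mono)
        fix x assume x: "x \<in> space ?Q"
        have "x \<in> PiE ?I (\<lambda>_. intervals_through (fst y))" if "x(i := y) \<in> ?B i"
        proof -
          have "fst (x j) \<le> fst y \<and> fst y \<le> snd (x j)" if "j \<in> ?I" for j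
            using \<open>x(i := y) \<in> ?B i\<close> that by (auto dest!: bspec[of _ _ j])
          then show ?thesis using x by (auto simp: space_PiM PiE_iff intervals_through_def space_PS[OF \<mu>])
        qed
        then show "indicator (?B i) (x(i := y)) \<le> (indicator (PiE ?I (\<lambda>_. intervals_through (fst y))) x :: ennreal)"
          by (simp add: indicator_def)
      qed
      also have "\<dots> = emeasure ?Q (PiE ?I (\<lambda>_. intervals_through (fst y)))"
        using intervals_through_sets[OF \<mu>] by (intro nn_integral_indicator sets_PiM_I_finite) auto
      also have "\<dots> = ennreal (measure \<mu> (intervals_through (fst y)) ^ m)"
        using Q.prob_times[of "\<lambda>_. intervals_through (fst y)"] intervals_through_sets[OF \<mu>] i by (simp add: Q.emeasure_eq_measure)
      also have "\<dots> \<le> ennreal (?w ^ m)"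
        using yS by (intro ennreal_leI power_mono intervals_through_le_measure_clique_number[OF \<mu>]) (auto simp: \<S>_def)
      finally show "(\<integral>\<^sup>+x. indicator (?B i) (x(i := y)) \<partial>?Q) \<le> ennreal (?w ^ m)" .
    qed
    also have "\<dots> = ennreal (?w ^ m)" by (simp add: emeasure_space_1)
    finally show "measure ?P (?B i) \<le> ?w ^ m"
      using measure_clique_number_bounds[OF \<mu>] by (simp add: P.emeasure_eq_measure)
  qed
  also have "\<dots> = real ?k * ?w ^ m" by simp
  finally show ?thesis
    unfolding measure_density_eq_prob[OF pair_graph_complete_graph \<mu>] complete_graph_sel(1) .
qed

lemma exists_power_gap:
  fixes u v :: real
  assumes "0 \<le> u" "u < v"
  obtains m where "real (Suc m) * u ^ m < v ^ Suc m"
proof -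
  have q: "norm (u / v) < 1" using assms by (simp add: abs_of_nonneg)
  have "(\<lambda>m. real m * (u / v) ^ m + (u / v) ^ m) \<longlonglongrightarrow> 0 + 0"
    by (intro tendsto_add powser_times_n_limit_0[OF q] LIMSEQ_power_zero[OF q])
  then have "\<forall>\<^sub>F m in sequentially. real m * (u / v) ^ m + (u / v) ^ m < v"
    using assms by (elim order_tendstoD(2)) auto
  then obtain m where "real m * (u / v) ^ m + (u / v) ^ m < v"
    by (auto simp: eventually_sequentially)
  then have "(real m * (u / v) ^ m + (u / v) ^ m) * v ^ m < v * v ^ m"
    using assms by (intro mult_strict_right_mono zero_less_power) auto
  moreover have "real (Suc m) * u ^ m = (real m * (u / v) ^ m + (u / v) ^ m) * v ^ m"
    using assms by (simp add: power_divide distrib_right)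
  ultimately have "real (Suc m) * u ^ m < v ^ Suc m" by (simp only: power_Suc)
  then show ?thesis by (rule that)
qed

text \<open>Both \<open>w\<close> and the \<open>x n\<close> are squeezed between powers of the same densities \<open>t m\<close>, up to the
polynomial factor \<open>Suc m\<close> and the vanishing shift \<open>Suc m / N n\<close>. By taking \<open>m\<close> large, any gap
between \<open>w\<close> and a limit point of \<open>x\<close> beats the polynomial factor.\<close>

lemma clique_density_squeeze:
  fixes w :: real and x N T :: "nat \<Rightarrow> real" and t :: "nat \<Rightarrow> nat \<Rightarrow> real"
  assumes w: "0 \<le> w" and x: "\<And>n. 0 \<le> x n"
    and N: "filterlim N at_top sequentially"
    and t: "\<And>m. (\<lambda>n. t m n) \<longlonglongrightarrow> T m"
    and upper: "\<And>m n. t m n \<le> real (Suc m) * x n ^ m"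
    and lower: "\<And>m n. real (Suc m) / N n \<le> x n \<Longrightarrow> (x n - real (Suc m) / N n) ^ Suc m \<le> t m n"
    and T: "\<And>m. w ^ Suc m \<le> T m" "\<And>m. T m \<le> real (Suc m) * w ^ m"
  shows "x \<longlonglongrightarrow> w"
proof (rule order_tendstoI)
  fix a assume a: "a < w"
  show "\<forall>\<^sub>F n in sequentially. a < x n"
  proof (cases "a < 0")
    case True
    then have "a < x n" for n using x[of n] by simp
    then show ?thesis by simp
  next
    case False
    with a obtain m where m: "real (Suc m) * a ^ m < w ^ Suc m"
      using exists_power_gap[of a w] by auto
    then have "real (Suc m) * a ^ m < T m" using T(1)[of m] by simp
    from order_tendstoD(1)[OF t this] show ?thesis
    proof eventually_elim
      case (elim n)
      then have "real (Suc m) * a ^ m < real (Suc m) * x n ^ m"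
        using upper[where m = m and n = n] by (rule less_le_trans)
      then have "a ^ m < x n ^ m" by (rule mult_left_less_imp_less) simp
      then show ?case using x by (rule power_less_imp_less_base)
    qed
  qed
next
  fix b assume b: "w < b"
  \<comment> \<open>The midpoint leaves room for the shift in the lower bound for t.\<close>
  define c where "c = (w + b) / 2"
  have c: "w < c" "c < b" "0 < c" using b w by (auto simp: c_def)
  obtain m where m: "real (Suc m) * w ^ m < c ^ Suc m"
    using exists_power_gap[OF w c(1)] by metis
  then have "T m < c ^ Suc m" using T(2)[of m] by linarith
  then have 1: "\<forall>\<^sub>F n in sequentially. t m n < c ^ Suc m" by (rule order_tendstoD(2)[OF t])
  have "((\<lambda>n. real (Suc m) / N n) \<longlongrightarrow> 0) sequentially"
    by (rule real_tendsto_divide_at_top[OF tendsto_const N])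
  then have 2: "\<forall>\<^sub>F n in sequentially. real (Suc m) / N n < b - c"
    using c(2) by (elim order_tendstoD(2)) simp
  show "\<forall>\<^sub>F n in sequentially. x n < b"
    using 1 2
  proof eventually_elim
    case (elim n)
    show ?case
    proof (cases "real (Suc m) / N n \<le> x n")
      case True
      have "(x n - real (Suc m) / N n) ^ Suc m < c ^ Suc m"
        using lower[OF True] elim(1) by (rule le_less_trans)
      then have "x n - real (Suc m) / N n < c" using c(3) by (auto elim: power_less_imp_less_base simp del: of_nat_Suc power_Suc)
      then show ?thesis using elim(2) by linarith
    next
      case False
      then show ?thesis using elim(2) c(3) by linarith
    qed
  qed
qed

section \<open>Measures representing limits of interval graphs\<close>

lemma prob_uniform_tuple:
  fixes V :: "'i set"
  assumes V: "finite V" and n: "n > 0"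
  defines "P \<equiv> \<Pi>\<^sub>M i\<in>V. measure_pmf (pmf_of_set {..<n :: nat})"
  shows "measure P {x \<in> space P. Q x} = real (card {x \<in> V \<rightarrow>\<^sub>E {..<n}. Q x}) / real n ^ card V"
proof -
  let ?p = "measure_pmf (pmf_of_set {..<n})"
  interpret P: finite_product_prob_space "\<lambda>_. ?p" V
    by (rule finite_product_prob_space_const) (use V in \<open>auto intro: prob_space_measure_pmf\<close>)
  have n': "{..<n} \<noteq> {}" using n by auto
  have space: "space P = V \<rightarrow>\<^sub>E UNIV" by (simp add: P_def space_PiM)
  have "sets P = sets (\<Pi>\<^sub>M i\<in>V. count_space (UNIV :: nat set))"
    unfolding P_def by (intro sets_PiM_cong) auto
  also have "\<dots> = Pow (V \<rightarrow>\<^sub>E UNIV)" using V by (simp add: count_space_PiM_finite)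
  finally have sets: "sets P = Pow (V \<rightarrow>\<^sub>E UNIV)" .
  let ?T = "V \<rightarrow>\<^sub>E {..<n}"
  have "measure P ?T = 1"
    unfolding P_def using P.prob_times[of "\<lambda>_. {..<n}"] n' n by (simp add: measure_pmf_of_set)
  moreover have "?T \<in> sets P" unfolding sets by auto
  ultimately have "AE x in P. x \<in> ?T" unfolding P_def by (simp add: P.prob_eq_1)
  then have "AE x in P. x \<in> {x \<in> space P. Q x} \<longleftrightarrow> x \<in> {x \<in> ?T. Q x}"
    by eventually_elim (auto simp: space)
  then have "measure P {x \<in> space P. Q x} = measure P {x \<in> ?T. Q x}"
    unfolding P_def
    by (intro P.finite_measure_eq_AE) (auto simp: sets[unfolded P_def] space[unfolded P_def])
  also have "\<dots> = (\<Sum>x\<in>{x \<in> ?T. Q x}. measure P {x})"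
    unfolding P_def
    by (intro P.finite_measure_eq_sum_singleton)
       (use V in \<open>auto simp: sets[unfolded P_def] intro!: finite_PiE intro: finite_subset[of _ ?T]\<close>)
  also have "\<dots> = (\<Sum>x\<in>{x \<in> ?T. Q x}. 1 / real n ^ card V)"
  proof (intro sum.cong refl)
    fix x assume "x \<in> {x \<in> ?T. Q x}"
    then have x: "x \<in> extensional V" "\<And>i. i \<in> V \<Longrightarrow> x i < n" by (auto simp: PiE_iff)
    have "measure P {x} = measure P (PiE V (\<lambda>i. {x i}))" using x by (simp add: PiE_singleton)
    also have "\<dots> = (\<Prod>i\<in>V. measure ?p {x i})" unfolding P_def by (rule P.prob_times) auto
    also have "\<dots> = (\<Prod>i\<in>V. 1 / real n)"
      using x n' by (intro prod.cong refl) (simp add: measure_pmf_of_set)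
    also have "\<dots> = 1 / real n ^ card V" by (simp add: power_one_over)
    finally show "measure P {x} = 1 / real n ^ card V" .
  qed
  finally show ?thesis by simp
qed

text \<open>The probability of an event about independent copies depends only on the common law of the
coordinates, not on the space on which they live.\<close>

lemma prob_product_transfer:
  fixes X :: "'b \<Rightarrow> 'c" and Y :: "'d \<Rightarrow> 'c"
  assumes V: "finite V" and M: "prob_space M" and N: "prob_space N"
    and X: "X \<in> measurable M B" and Y: "Y \<in> measurable N B"
    and law: "distr M B X = distr N B Y"
    and Q: "{z \<in> space (\<Pi>\<^sub>M i\<in>V. B). Q z} \<in> sets (\<Pi>\<^sub>M i\<in>V. B)"
  shows "measure (\<Pi>\<^sub>M i\<in>V. M) {x \<in> space (\<Pi>\<^sub>M i\<in>V. M). Q (compose V X x)}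
       = measure (\<Pi>\<^sub>M i\<in>V. N) {x \<in> space (\<Pi>\<^sub>M i\<in>V. N). Q (compose V Y x)}"
proof -
  have *: "measure (\<Pi>\<^sub>M i\<in>V. K) {x \<in> space (\<Pi>\<^sub>M i\<in>V. K). Q (compose V Z x)}
      = measure (\<Pi>\<^sub>M i\<in>V. distr K B Z) {z \<in> space (\<Pi>\<^sub>M i\<in>V. B). Q z}"
    if K: "prob_space K" and Z: "Z \<in> measurable K B" for K :: "'e measure" and Z
  proof -
    have B: "sets (\<Pi>\<^sub>M i\<in>V. distr K B Z) = sets (\<Pi>\<^sub>M i\<in>V. B)" by (intro sets_PiM_cong) auto
    have comp: "compose V Z \<in> measurable (\<Pi>\<^sub>M i\<in>V. K) (\<Pi>\<^sub>M i\<in>V. B)"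
      unfolding compose_def using Z by measurable
    have "(\<Pi>\<^sub>M i\<in>V. distr K B Z) = distr (\<Pi>\<^sub>M i\<in>V. K) (\<Pi>\<^sub>M i\<in>V. distr K B Z) (compose V Z)"
      using distr_PiM_finite_prob_space'[of V "\<lambda>_. K" "\<lambda>_. distr K B Z" Z] V K Z
        prob_space.prob_space_distr[OF K Z]
      by (simp add: distr_cong[OF refl sets_distr refl])
    also have "\<dots> = distr (\<Pi>\<^sub>M i\<in>V. K) (\<Pi>\<^sub>M i\<in>V. B) (compose V Z)"
      by (intro distr_cong refl B)
    finally have "(\<Pi>\<^sub>M i\<in>V. distr K B Z) = distr (\<Pi>\<^sub>M i\<in>V. K) (\<Pi>\<^sub>M i\<in>V. B) (compose V Z)" .
    then have "measure (\<Pi>\<^sub>M i\<in>V. distr K B Z) {z \<in> space (\<Pi>\<^sub>M i\<in>V. B). Q z}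
       = measure (\<Pi>\<^sub>M i\<in>V. K) (compose V Z -` {z \<in> space (\<Pi>\<^sub>M i\<in>V. B). Q z} \<inter> space (\<Pi>\<^sub>M i\<in>V. K))"
      using measure_distr[OF comp Q] by simp
    also have "compose V Z -` {z \<in> space (\<Pi>\<^sub>M i\<in>V. B). Q z} \<inter> space (\<Pi>\<^sub>M i\<in>V. K)
       = {x \<in> space (\<Pi>\<^sub>M i\<in>V. K). Q (compose V Z x)}"
      using measurable_space[OF comp] by auto
    finally show ?thesis by simp
  qed
  show ?thesis using *[OF M X] *[OF N Y] law by simp
qed

lemma borel_measurable_coords:
  fixes f :: "'b \<Rightarrow> real \<times> real"
  assumes "f \<in> borel_measurable M"
  shows "(\<lambda>x. fst (f x)) \<in> borel_measurable M" "(\<lambda>x. snd (f x)) \<in> borel_measurable M"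
  by (rule measurable_compose[OF assms],
      auto intro!: borel_measurable_continuous_onI continuous_intros)+

text \<open>Adjacency in a finite interval graph with distinct left endpoints. The first conjunct excludes two
copies of the same vertex, so that homomorphism densities become exactly probabilities of this
relation, with no correction for maps that identify vertices.\<close>

definition strict_meet :: "real \<times> real \<Rightarrow> real \<times> real \<Rightarrow> bool" where
  "strict_meet I J \<longleftrightarrow> fst I \<noteq> fst J \<and> fst I \<le> snd J \<and> fst J \<le> snd I"

lemma strict_meet_event_measurable:
  fixes F :: "nat pair_pre_digraph"
  assumes F: "pair_graph F"
    and X: "\<And>i. i \<in> pverts F \<Longrightarrow> (\<lambda>\<omega>. X i \<omega>) \<in> borel_measurable M"
  shows "{\<omega> \<in> space M. \<forall>(i, j)\<in>parcs F. strict_meet (X i \<omega>) (X j \<omega>)} \<in> sets M"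
proof -
  have fin: "finite (parcs F)" using pair_graph_finite_arcs[OF F] .
  have "{\<omega> \<in> space M. strict_meet (X (fst a) \<omega>) (X (snd a) \<omega>)} \<in> sets M" if "a \<in> parcs F" for a
  proof -
    have X': "X (fst a) \<in> borel_measurable M" "X (snd a) \<in> borel_measurable M"
      using that pair_graph_arcs[OF F, of "fst a" "snd a"] X by auto
    note [measurable] = borel_measurable_coords[OF X'(1)] borel_measurable_coords[OF X'(2)]
    show ?thesis unfolding strict_meet_def by measurable
  qed
  then have "{\<omega> \<in> space M. \<forall>a\<in>parcs F. strict_meet (X (fst a) \<omega>) (X (snd a) \<omega>)} \<in> sets M"
    by (intro sets.sets_Collect_finite_All fin)
  then show ?thesis by (simp add: case_prod_unfold)
qed

definition vertex_interval :: "'a pair_pre_digraph \<Rightarrow> (nat \<Rightarrow> 'a) \<Rightarrow> nat \<Rightarrow> real \<times> real" where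
  "vertex_interval G e i =
     (real i / real (card (pverts G)), real (last_nbr G e i) / real (card (pverts G)))"

lemma vertex_interval_adj:
  assumes e: "interval_ordering G e" and ij: "i < card (pverts G)" "j < card (pverts G)"
  shows "(e i, e j) \<in> parcs G \<longleftrightarrow> strict_meet (vertex_interval G e i) (vertex_interval G e j)"
  using interval_ordering_adj[OF e ij] ij by (auto simp: strict_meet_def vertex_interval_def divide_le_cancel)

lemma vertex_interval_in_S:
  assumes "i < card (pverts G)"
  shows "vertex_interval G e i \<in> \<S>"
  using last_nbr_bounds[OF assms, of e] assms
  by (auto simp: vertex_interval_def \<S>_def divide_le_cancel divide_le_eq_1)

text \<open>If \<open>X\<close> has the law of the interval of a uniformly random vertex, then independent copies of \<open>X\<close> are
the intervals of a uniformly random map from \<open>F\<close> to \<open>G\<close>.\<close>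

lemma hom_density_eq_prob:
  fixes F :: "nat pair_pre_digraph" and X :: "'b \<Rightarrow> real \<times> real"
  assumes F: "pair_graph F" and e: "interval_ordering G e" and n: "card (pverts G) > 0"
    and M: "prob_space M" and X: "X \<in> borel_measurable M"
    and law: "distr M borel X
       = distr (measure_pmf (pmf_of_set {..<card (pverts G)})) borel (vertex_interval G e)"
  shows "hom_density F G = measure (\<Pi>\<^sub>M i\<in>pverts F. M)
     {\<omega> \<in> space (\<Pi>\<^sub>M i\<in>pverts F. M). \<forall>(i, j)\<in>parcs F. strict_meet (X (\<omega> i)) (X (\<omega> j))}"
proof -
  let ?n = "card (pverts G)" and ?V = "pverts F" and ?v = "vertex_interval G e"
  let ?p = "measure_pmf (pmf_of_set {..<?n})"
  let ?Q = "\<lambda>z. \<forall>(i, j)\<in>parcs F. strict_meet (z i) (z j)"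
  have V: "finite ?V" using pair_graph_finite[OF F] .
  have bij: "bij_betw e {..<?n} (pverts G)"
    using e unfolding interval_ordering_def by blast
  have Q_compose: "?Q (compose ?V f x) \<longleftrightarrow> (\<forall>(i, j)\<in>parcs F. strict_meet (f (x i)) (f (x j)))" for f :: "'z \<Rightarrow> _" and x
    using pair_graph_arcs[OF F] by (force simp: compose_def)
  have "measure (\<Pi>\<^sub>M i\<in>?V. M) {\<omega> \<in> space (\<Pi>\<^sub>M i\<in>?V. M). ?Q (compose ?V X \<omega>)}
      = measure (\<Pi>\<^sub>M i\<in>?V. ?p) {x \<in> space (\<Pi>\<^sub>M i\<in>?V. ?p). ?Q (compose ?V ?v x)}"
    by (rule prob_product_transfer[OF V M prob_space_measure_pmf X _ law])
       (auto intro!: strict_meet_event_measurable[OF F])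
  also have "\<dots> = real (card {x \<in> ?V \<rightarrow>\<^sub>E {..<?n}. ?Q (compose ?V ?v x)}) / real ?n ^ card ?V"
    by (rule prob_uniform_tuple[OF V n])
  also have "card {x \<in> ?V \<rightarrow>\<^sub>E {..<?n}. ?Q (compose ?V ?v x)} = card (graph_homs F G)"
  proof (rule bij_betw_same_card)
    let ?A = "{x \<in> ?V \<rightarrow>\<^sub>E {..<?n}. ?Q (compose ?V ?v x)}"
    have adj: "(e (x i), e (x j)) \<in> parcs G \<longleftrightarrow> strict_meet (?v (x i)) (?v (x j))"
      if "x \<in> ?V \<rightarrow>\<^sub>E {..<?n}" "(i, j) \<in> parcs F" for x i j
    proof -
      have "i \<in> ?V" "j \<in> ?V" using pair_graph_arcs[OF F that(2)] by auto
      then have "x i < ?n" "x j < ?n" using that(1) by auto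
      then show ?thesis by (rule vertex_interval_adj[OF e])
    qed
    have eq: "compose ?V e x \<in> graph_homs F G \<longleftrightarrow> x \<in> ?A" if x: "x \<in> ?V \<rightarrow>\<^sub>E {..<?n}" for x
    proof -
      have "compose ?V e x \<in> ?V \<rightarrow>\<^sub>E pverts G"
        using x bij by (auto simp: compose_def bij_betw_def PiE_iff)
      moreover have "(compose ?V e x i, compose ?V e x j) \<in> parcs G \<longleftrightarrow> strict_meet (?v (x i)) (?v (x j))"
        if "(i, j) \<in> parcs F" for i j
        using adj[OF x that] pair_graph_arcs[OF F that] by (simp add: compose_def)
      ultimately show ?thesis using x unfolding graph_homs_def Q_compose by blast
    qed
    show "bij_betw (compose ?V e) ?A (graph_homs F G)"
    proof (rule bij_betwI[where g = "compose ?V (inv_into {..<?n} e)"])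
      show "compose ?V e \<in> ?A \<rightarrow> graph_homs F G" using eq by auto
      have pull: "compose ?V (inv_into {..<?n} e) \<phi> \<in> ?V \<rightarrow>\<^sub>E {..<?n}"
          "compose ?V e (compose ?V (inv_into {..<?n} e) \<phi>) = \<phi>"
        if \<phi>: "\<phi> \<in> graph_homs F G" for \<phi>
      proof -
        have \<phi>': "\<phi> \<in> ?V \<rightarrow>\<^sub>E pverts G" using \<phi> by (simp add: graph_homs_def)
        have inv: "inv_into {..<?n} e (\<phi> i) < ?n" "e (inv_into {..<?n} e (\<phi> i)) = \<phi> i" if "i \<in> ?V" for i
        proof -
          have im: "\<phi> i \<in> e ` {..<?n}" using \<phi>' that bij by (auto simp: bij_betw_def)
          show "inv_into {..<?n} e (\<phi> i) < ?n" using inv_into_into[OF im] by simp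
          show "e (inv_into {..<?n} e (\<phi> i)) = \<phi> i" using f_inv_into_f[OF im] .
        qed
        show "compose ?V (inv_into {..<?n} e) \<phi> \<in> ?V \<rightarrow>\<^sub>E {..<?n}"
          using inv by (auto simp: compose_def PiE_iff)
        show "compose ?V e (compose ?V (inv_into {..<?n} e) \<phi>) = \<phi>"
          using inv(2) \<phi>' by (auto simp: compose_def PiE_iff extensional_def fun_eq_iff)
      qed
      show "compose ?V (inv_into {..<?n} e) \<in> graph_homs F G \<rightarrow> ?A"
      proof
        fix \<phi> assume \<phi>: "\<phi> \<in> graph_homs F G"
        then show "compose ?V (inv_into {..<?n} e) \<phi> \<in> ?A"
          using eq[OF pull(1)[OF \<phi>]] pull(2)[OF \<phi>] by simp
      qed
      show "compose ?V (inv_into {..<?n} e) (compose ?V e x) = x" if "x \<in> ?A" for x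
      proof -
        have x: "x \<in> ?V \<rightarrow>\<^sub>E {..<?n}" using that by blast
        have "inv_into {..<?n} e (e (x i)) = x i" if "i \<in> ?V" for i
          using bij x that by (intro inv_into_f_f) (auto simp: bij_betw_def)
        then show ?thesis using x by (auto simp: compose_def PiE_iff extensional_def fun_eq_iff)
      qed
      show "compose ?V e (compose ?V (inv_into {..<?n} e) \<phi>) = \<phi>" if "\<phi> \<in> graph_homs F G" for \<phi>
        using pull(2)[OF that] .
    qed
  qed
  also have "real (card (graph_homs F G)) / real ?n ^ card ?V = hom_density F G"
    using V by (simp add: hom_density_def card_PiE)
  finally show ?thesis unfolding Q_compose ..
qed

lemma card_grid_near:
  assumes n: "n > 0" and d: "d > 0"
  shows "real (card {i \<in> {..<n}. \<bar>real i / real n - a\<bar> < d}) \<le> 2 * d * real n + 1"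
proof -
  let ?A = "{i \<in> {..<n}. \<bar>real i / real n - a\<bar> < d}"
  let ?l = "\<lceil>(a - d) * real n\<rceil>" and ?u = "\<lfloor>(a + d) * real n\<rfloor>"
  have "int ` ?A \<subseteq> {?l..?u}"
  proof
    fix z assume "z \<in> int ` ?A"
    then obtain i where i: "z = int i" "\<bar>real i / real n - a\<bar> < d" by blast
    then have "a - d \<le> real i / real n" "real i / real n \<le> a + d" by linarith+
    then have "(a - d) * real n \<le> real i" "real i \<le> (a + d) * real n"
      using n by (simp_all add: pos_le_divide_eq pos_divide_le_eq)
    then show "z \<in> {?l..?u}" using i by (simp add: ceiling_le_iff le_floor_iff)
  qed
  then have "card (int ` ?A) \<le> card {?l..?u}" by (intro card_mono) auto
  then have "card ?A \<le> nat (?u - ?l + 1)" by (simp add: card_image)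
  moreover have "real_of_int (?u - ?l + 1) \<le> 2 * d * real n + 1"
  proof -
    have "real_of_int ?u \<le> (a + d) * real n" "(a - d) * real n \<le> real_of_int ?l" by linarith+
    moreover have "(a + d) * real n - (a - d) * real n = 2 * d * real n" by (simp add: algebra_simps)
    ultimately have "real_of_int ?u - real_of_int ?l \<le> 2 * d * real n" by linarith
    then show ?thesis by simp
  qed
  moreover have "0 \<le> 2 * d * real n + 1" using d by simp
  ultimately show ?thesis by linarith
qed

text \<open>A window of radius \<open>d\<close> contains at most \<open>2 * d * N + 1\<close> of the \<open>N\<close> grid points, so the grid laws
put mass at most \<open>2 * d + 1 / N\<close> on it. A tent function of width \<open>d\<close> carries this bound over
to the limit, where \<open>d\<close> can be made small.\<close>

lemma atomless_limit_of_grids: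
  fixes X :: "'b \<Rightarrow> real" and Xs :: "nat \<Rightarrow> 'b \<Rightarrow> real" and N :: "nat \<Rightarrow> nat"
  assumes M: "prob_space M"
    and Xs [measurable]: "\<And>n. Xs n \<in> borel_measurable M"
    and X [measurable]: "X \<in> borel_measurable M"
    and lim: "\<And>\<omega>. \<omega> \<in> space M \<Longrightarrow> (\<lambda>n. Xs n \<omega>) \<longlonglongrightarrow> X \<omega>"
    and N0: "\<And>n. N n > 0" and N: "filterlim N at_top sequentially"
    and law: "\<And>n. distr M borel (Xs n)
       = distr (measure_pmf (pmf_of_set {..<N n})) borel (\<lambda>i. real i / real (N n))"
  shows "measure M {\<omega> \<in> space M. X \<omega> = a} = 0"
proof -
  interpret prob_space M by fact
  have le: "measure M {\<omega> \<in> space M. X \<omega> = a} \<le> 2 * d" if d: "d > 0" for d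
  proof -
    define h where "h x = max 0 (1 - \<bar>x - a\<bar> / d)" for x :: real
    have h: "0 \<le> h x" "h x \<le> indicator {x. \<bar>x - a\<bar> < d} x" "h x \<le> 1" "h a = 1" for x
      using d by (auto simp: h_def indicator_def field_simps)
    have hc: "continuous_on UNIV h" unfolding h_def using d by (intro continuous_intros) auto
    have [measurable]: "h \<in> borel_measurable borel" using hc by (rule borel_measurable_continuous_onI)
    have "(\<lambda>n. \<integral>\<omega>. h (Xs n \<omega>) \<partial>M) \<longlonglongrightarrow> (\<integral>\<omega>. h (X \<omega>) \<partial>M)"
    proof (rule integral_dominated_convergence[where w = "\<lambda>_. 1"])
      show "AE \<omega> in M. (\<lambda>n. h (Xs n \<omega>)) \<longlonglongrightarrow> h (X \<omega>)"
        using lim by (auto intro!: AE_I2 continuous_on_tendsto_compose[OF hc])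
      show "AE \<omega> in M. norm (h (Xs n \<omega>)) \<le> 1" for n using h by simp
    qed auto
    moreover have "(\<integral>\<omega>. h (Xs n \<omega>) \<partial>M) \<le> 2 * d + 1 / real (N n)" for n
    proof -
      let ?p = "measure_pmf (pmf_of_set {..<N n})"
      have ne: "{..<N n} \<noteq> {}" using N0[of n] by auto
      have "(\<integral>\<omega>. h (Xs n \<omega>) \<partial>M) = (\<integral>x. h x \<partial>distr M borel (Xs n))"
        by (rule integral_distr[symmetric]) auto
      also have "\<dots> = (\<integral>i. h (real i / real (N n)) \<partial>?p)"
        unfolding law by (rule integral_distr) auto
      also have "\<dots> \<le> (\<integral>i. indicator {i. \<bar>real i / real (N n) - a\<bar> < d} i \<partial>?p)"
      proof (rule integral_mono)
        show "integrable ?p (\<lambda>i. h (real i / real (N n)))"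
          using h by (intro measure_pmf.integrable_const_bound[where B = 1]) auto
        show "integrable ?p (\<lambda>i. indicator {i. \<bar>real i / real (N n) - a\<bar> < d} i :: real)"
          by (intro measure_pmf.integrable_const_bound[where B = 1]) auto
      qed (use h(2) in \<open>simp add: indicator_def\<close>)
      also have "\<dots> = measure ?p {i. \<bar>real i / real (N n) - a\<bar> < d}" by simp
      also have "\<dots> = real (card {i \<in> {..<N n}. \<bar>real i / real (N n) - a\<bar> < d}) / real (N n)"
        using ne by (simp add: measure_pmf_of_set Int_def)
      also have "\<dots> \<le> (2 * d * real (N n) + 1) / real (N n)"
        by (intro divide_right_mono card_grid_near N0 d) auto
      also have "\<dots> = 2 * d + 1 / real (N n)" using N0[of n] by (simp add: field_simps)
      finally show ?thesis .
    qed
    moreover have "(\<lambda>n. 2 * d + 1 / real (N n)) \<longlonglongrightarrow> 2 * d + 0"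
      by (intro tendsto_add tendsto_const real_tendsto_divide_at_top[OF tendsto_const]
          filterlim_compose[OF filterlim_real_sequentially N])
    ultimately have "(\<integral>\<omega>. h (X \<omega>) \<partial>M) \<le> 2 * d + 0"
      by (intro LIMSEQ_le[where Y = "\<lambda>n. 2 * d + 1 / real (N n)"]) auto
    moreover have "measure M {\<omega> \<in> space M. X \<omega> = a} \<le> (\<integral>\<omega>. h (X \<omega>) \<partial>M)"
    proof -
      have "measure M {\<omega> \<in> space M. X \<omega> = a} = (\<integral>\<omega>. indicator {\<omega> \<in> space M. X \<omega> = a} \<omega> \<partial>M)"
        by (simp add: Int_def) (metis (no_types, lifting))
      also have "\<dots> \<le> (\<integral>\<omega>. h (X \<omega>) \<partial>M)"
      proof (rule integral_mono)
        show "integrable M (\<lambda>\<omega>. h (X \<omega>))"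
          using h by (intro integrable_const_bound[where B = 1]) auto
        show "integrable M (\<lambda>\<omega>. indicator {\<omega> \<in> space M. X \<omega> = a} \<omega> :: real)"
          by (intro integrable_const_bound[where B = 1]) auto
      qed (use h(1,4) in \<open>auto simp: indicator_def\<close>)
      finally show ?thesis .
    qed
    ultimately show ?thesis by simp
  qed
  have "measure M {\<omega> \<in> space M. X \<omega> = a} \<le> 0"
  proof (rule field_le_epsilon)
    fix e :: real assume "0 < e"
    then show "measure M {\<omega> \<in> space M. X \<omega> = a} \<le> 0 + e" using le[of "e / 2"] by simp
  qed
  then show ?thesis using measure_nonneg[of M] by (simp add: antisym)
qed

text \<open>By Fubini, coordinate \<open>i\<close> can be integrated first, while coordinate \<open>j\<close> fixes the value that \<open>h\<close> would
have to hit.\<close>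

lemma AE_PiM_neq:
  fixes g h :: "'b \<Rightarrow> real"
  assumes M: "prob_space M" and V: "finite V" "i \<in> V" "j \<in> V" "i \<noteq> j"
    and [measurable]: "g \<in> borel_measurable M" "h \<in> borel_measurable M"
    and atomless: "\<And>a. measure M {\<omega> \<in> space M. h \<omega> = a} = 0"
  shows "AE \<omega> in \<Pi>\<^sub>M i\<in>V. M. h (\<omega> i) \<noteq> g (\<omega> j)"
proof -
  interpret prob_space M by fact
  let ?P = "\<Pi>\<^sub>M i\<in>V. M" and ?U = "V - {i}"
  interpret P: finite_product_prob_space "\<lambda>_. M" V
    by (rule finite_product_prob_space_const[OF M V(1)])
  note [measurable] = V(2,3)
  let ?B = "{\<omega> \<in> space ?P. h (\<omega> i) = g (\<omega> j)}"
  have ins: "insert i ?U = V" using V by auto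
  have B: "?B \<in> sets ?P" by measurable
  have meas: "indicator ?B \<in> borel_measurable (\<Pi>\<^sub>M i\<in>insert i ?U. M)"
    unfolding ins using B by (rule borel_measurable_indicator)
  have "emeasure ?P ?B = (\<integral>\<^sup>+\<omega>. indicator ?B \<omega> \<partial>(\<Pi>\<^sub>M i\<in>insert i ?U. M))"
    unfolding ins using B by simp
  also have "\<dots> = (\<integral>\<^sup>+x. (\<integral>\<^sup>+y. indicator ?B (x(i := y)) \<partial>M) \<partial>(\<Pi>\<^sub>M i\<in>?U. M))"
    by (rule P.product_nn_integral_insert[OF _ _ meas]) (use V(1) in auto)
  also have "\<dots> = (\<integral>\<^sup>+x. 0 \<partial>(\<Pi>\<^sub>M i\<in>?U. M))"
  proof (rule nn_integral_cong)
    fix x assume x: "x \<in> space (\<Pi>\<^sub>M i\<in>?U. M)"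
    have "(\<integral>\<^sup>+y. indicator ?B (x(i := y)) \<partial>M) \<le> (\<integral>\<^sup>+y. indicator {\<omega> \<in> space M. h \<omega> = g (x j)} y \<partial>M)"
      using V(4) by (intro nn_integral_mono) (auto simp: indicator_def)
    also have "\<dots> = emeasure M {\<omega> \<in> space M. h \<omega> = g (x j)}" by (rule nn_integral_indicator) measurable
    also have "\<dots> = 0" using atomless by (simp add: emeasure_eq_measure)
    finally show "(\<integral>\<^sup>+y. indicator ?B (x(i := y)) \<partial>M) = 0" by simp
  qed
  finally have "emeasure ?P ?B = 0" by simp
  then show ?thesis using B by (subst AE_iff_measurable[OF B]) auto
qed

text \<open>The function \<open>W\<close> is discontinuous only where the left endpoint of one interval equals the right
endpoint of the other. As left endpoints have no atoms, independent intervals almost surely avoid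
this and also have different left endpoints. Whenever this is so, the finite events agree with the
limit event eventually, and dominated convergence applies.\<close>

lemma prob_meet_limit:
  fixes F :: "nat pair_pre_digraph" and X :: "'b \<Rightarrow> real \<times> real" and Xs :: "nat \<Rightarrow> 'b \<Rightarrow> real \<times> real"
  assumes F: "pair_graph F" and M: "prob_space M"
    and Xs [measurable]: "\<And>n. Xs n \<in> borel_measurable M"
    and X [measurable]: "X \<in> borel_measurable M"
    and XS: "\<And>\<omega>. \<omega> \<in> space M \<Longrightarrow> X \<omega> \<in> \<S>"
    and lim: "\<And>\<omega>. \<omega> \<in> space M \<Longrightarrow> (\<lambda>n. Xs n \<omega>) \<longlonglongrightarrow> X \<omega>"
    and atomless: "\<And>a. measure M {\<omega> \<in> space M. fst (X \<omega>) = a} = 0"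
  defines "P \<equiv> \<Pi>\<^sub>M i\<in>pverts F. M"
  shows "(\<lambda>n. measure P {\<omega> \<in> space P. \<forall>(i, j)\<in>parcs F. strict_meet (Xs n (\<omega> i)) (Xs n (\<omega> j))})
    \<longlonglongrightarrow> measure P {\<omega> \<in> space P. \<forall>(i, j)\<in>parcs F. W (X (\<omega> i)) (X (\<omega> j)) = 1}"
proof -
  have V: "finite (pverts F)" using pair_graph_finite[OF F] .
  have fin: "finite (parcs F)" using pair_graph_finite_arcs[OF F] .
  interpret P: finite_product_prob_space "\<lambda>_. M" "pverts F"
    by (rule finite_product_prob_space_const[OF M V])
  let ?En = "\<lambda>n. {\<omega> \<in> space P. \<forall>(i, j)\<in>parcs F. strict_meet (Xs n (\<omega> i)) (Xs n (\<omega> j))}"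
  let ?E = "{\<omega> \<in> space P. \<forall>(i, j)\<in>parcs F. W (X (\<omega> i)) (X (\<omega> j)) = 1}"
  have En: "?En n \<in> sets P" for n
    unfolding P_def
    by (intro strict_meet_event_measurable[OF F] measurable_compose[OF _ Xs]
        measurable_component_singleton)
  have E: "?E \<in> sets P"
    unfolding P_def by (intro W_event_measurable[OF F] borel_measurable_coords X)
  have "\<forall>a\<in>parcs F. AE \<omega> in P. fst (X (\<omega> (fst a))) \<noteq> fst (X (\<omega> (snd a)))
      \<and> fst (X (\<omega> (fst a))) \<noteq> snd (X (\<omega> (snd a))) \<and> fst (X (\<omega> (snd a))) \<noteq> snd (X (\<omega> (fst a)))"
  proof
    fix a assume "a \<in> parcs F"
    then have a: "fst a \<in> pverts F" "snd a \<in> pverts F" "fst a \<noteq> snd a"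
      using pair_graph_arcs[OF F, of "fst a" "snd a"] by auto
    have m: "(\<lambda>\<omega>. fst (X \<omega>)) \<in> borel_measurable M" "(\<lambda>\<omega>. snd (X \<omega>)) \<in> borel_measurable M"
      by (rule borel_measurable_coords[OF X])+
    show "AE \<omega> in P. fst (X (\<omega> (fst a))) \<noteq> fst (X (\<omega> (snd a)))
      \<and> fst (X (\<omega> (fst a))) \<noteq> snd (X (\<omega> (snd a))) \<and> fst (X (\<omega> (snd a))) \<noteq> snd (X (\<omega> (fst a)))"
      unfolding P_def
      using AE_PiM_neq[OF M V a m(1) m(1) atomless] AE_PiM_neq[OF M V a m(2) m(1) atomless]
        AE_PiM_neq[OF M V a(2,1) a(3)[symmetric] m(2) m(1) atomless]
      by eventually_elim auto
  qed
  then have AE: "AE \<omega> in P. \<forall>a\<in>parcs F. fst (X (\<omega> (fst a))) \<noteq> fst (X (\<omega> (snd a)))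
      \<and> fst (X (\<omega> (fst a))) \<noteq> snd (X (\<omega> (snd a))) \<and> fst (X (\<omega> (snd a))) \<noteq> snd (X (\<omega> (fst a)))"
    by (intro AE_finite_allI fin) auto
  have "AE \<omega> in P. (\<lambda>n. indicator (?En n) \<omega> :: real) \<longlonglongrightarrow> indicator ?E \<omega>"
    using AE AE_space
  proof eventually_elim
    case (elim \<omega>)
    then have sp: "\<omega> i \<in> space M" if "i \<in> pverts F" for i
      using that by (auto simp: P_def space_PiM)
    have "\<forall>\<^sub>F n in sequentially. strict_meet (Xs n (\<omega> (fst a))) (Xs n (\<omega> (snd a)))
        \<longleftrightarrow> W (X (\<omega> (fst a))) (X (\<omega> (snd a))) = 1" if a: "a \<in> parcs F" for a
    proof -
      let ?i = "fst a" and ?j = "snd a"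
      have ij: "?i \<in> pverts F" "?j \<in> pverts F"
        using pair_graph_arcs[OF F, of "fst a" "snd a"] a by auto
      have l: "(\<lambda>n. fst (Xs n (\<omega> k))) \<longlonglongrightarrow> fst (X (\<omega> k))" "(\<lambda>n. snd (Xs n (\<omega> k))) \<longlonglongrightarrow> snd (X (\<omega> k))"
        if "k \<in> pverts F" for k
        using lim[OF sp[OF that]] by (auto intro: tendsto_fst tendsto_snd)
      have cmp: "\<forall>\<^sub>F n in sequentially. (u n \<le> v n \<longleftrightarrow> u' \<le> v') \<and> u n \<noteq> v n"
        if "u \<longlonglongrightarrow> u'" "v \<longlonglongrightarrow> v'" "u' \<noteq> v'" for u v :: "nat \<Rightarrow> real" and u' v'
      proof -
        have d: "(\<lambda>n. u n - v n) \<longlonglongrightarrow> u' - v'" using that by (intro tendsto_diff)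
        show ?thesis
        proof (cases "u' < v'")
          case True
          then have "\<forall>\<^sub>F n in sequentially. u n - v n < 0" by (intro order_tendstoD(2)[OF d]) simp
          then show ?thesis by eventually_elim (use True in auto)
        next
          case False
          then have "\<forall>\<^sub>F n in sequentially. 0 < u n - v n"
            using that(3) by (intro order_tendstoD(1)[OF d]) simp
          then show ?thesis by eventually_elim (use False that(3) in auto)
        qed
      qed
      have ne: "fst (X (\<omega> ?i)) \<noteq> fst (X (\<omega> ?j))" "fst (X (\<omega> ?i)) \<noteq> snd (X (\<omega> ?j))"
          "fst (X (\<omega> ?j)) \<noteq> snd (X (\<omega> ?i))"
        using elim(1) a by auto
      show ?thesis
        using cmp[OF l(1)[OF ij(1)] l(1)[OF ij(2)] ne(1)] cmp[OF l(1)[OF ij(1)] l(2)[OF ij(2)] ne(2)]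
          cmp[OF l(1)[OF ij(2)] l(2)[OF ij(1)] ne(3)]
        by eventually_elim
           (auto simp: strict_meet_def W_eq_1_iff[OF XS[OF sp[OF ij(1)]] XS[OF sp[OF ij(2)]]])
    qed
    then have "\<forall>\<^sub>F n in sequentially. \<forall>a\<in>parcs F. strict_meet (Xs n (\<omega> (fst a))) (Xs n (\<omega> (snd a)))
        \<longleftrightarrow> W (X (\<omega> (fst a))) (X (\<omega> (snd a))) = 1"
      by (intro eventually_ball_finite fin) auto
    then have "\<forall>\<^sub>F n in sequentially. indicator (?En n) \<omega> = (indicator ?E \<omega> :: real)"
      by eventually_elim (auto simp: indicator_def case_prod_unfold)
    then show ?case by (rule tendsto_eventually)
  qed
  then have "(\<lambda>n. \<integral>\<omega>. indicator (?En n) \<omega> \<partial>P) \<longlonglongrightarrow> (\<integral>\<omega>. indicator ?E \<omega> \<partial>P :: real)"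
    using En E unfolding P_def
    by (intro integral_dominated_convergence[where w = "\<lambda>_. 1"])
       (auto intro!: borel_measurable_indicator)
  moreover have "?En n \<inter> space P = ?En n" "?E \<inter> space P = ?E" for n by auto
  ultimately show ?thesis by simp
qed

lemma distr_in_PS:
  assumes M: "prob_space M"
    and X: "X \<in> borel_measurable M" and XS: "\<And>\<omega>. \<omega> \<in> space M \<Longrightarrow> X \<omega> \<in> \<S>"
  shows "distr M (restrict_space borel \<S>) X \<in> \<P>\<S>"
proof -
  have "X \<in> measurable M (restrict_space borel \<S>)"
    using X XS by (intro measurable_restrict_space2) auto
  then show ?thesis
    using prob_space.prob_space_distr[OF M] by (simp add: \<P>\<S>_def)
qed

lemma measure_density_distr:
  fixes F :: "nat pair_pre_digraph" and X :: "'b \<Rightarrow> real \<times> real"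
  assumes F: "pair_graph F" and M: "prob_space M"
    and X: "X \<in> borel_measurable M" and XS: "\<And>\<omega>. \<omega> \<in> space M \<Longrightarrow> X \<omega> \<in> \<S>"
  defines "\<mu> \<equiv> distr M (restrict_space borel \<S>) X" and "P \<equiv> \<Pi>\<^sub>M i\<in>pverts F. M"
  shows "measure_density F \<mu> = measure P {\<omega> \<in> space P. \<forall>(i, j)\<in>parcs F. W (X (\<omega> i)) (X (\<omega> j)) = 1}"
proof -
  let ?B = "restrict_space borel \<S> :: (real \<times> real) measure"
  let ?V = "pverts F"
  let ?Q = "\<lambda>z. \<forall>(i, j)\<in>parcs F. W (z i) (z j) = 1"
  have V: "finite ?V" using pair_graph_finite[OF F] .
  have X': "X \<in> measurable M ?B"
    using X XS by (intro measurable_restrict_space2) auto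
  have \<mu>: "\<mu> \<in> \<P>\<S>" unfolding \<mu>_def by (rule distr_in_PS[OF M X XS])
  have B: "sets (\<Pi>\<^sub>M i\<in>?V. \<mu>) = sets (\<Pi>\<^sub>M i\<in>?V. ?B)"
    by (intro sets_PiM_cong) (auto simp: \<mu>_def)
  have Q: "{z \<in> space (\<Pi>\<^sub>M i\<in>?V. ?B). ?Q z} \<in> sets (\<Pi>\<^sub>M i\<in>?V. ?B)"
    using W_event_measurable[OF F, of "\<lambda>x. x" \<mu>] PS_measurable[OF \<mu>]
    unfolding B sets_eq_imp_space_eq[OF B] by simp
  have "measure_density F \<mu> = measure (\<Pi>\<^sub>M i\<in>?V. \<mu>) {x \<in> space (\<Pi>\<^sub>M i\<in>?V. \<mu>). ?Q x}"
    by (rule measure_density_eq_prob[OF F \<mu>])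
  also have "{x \<in> space (\<Pi>\<^sub>M i\<in>?V. \<mu>). ?Q x} = {x \<in> space (\<Pi>\<^sub>M i\<in>?V. \<mu>). ?Q (compose ?V (\<lambda>x. x) x)}"
    using pair_graph_arcs[OF F] by (force simp: compose_def)
  also have "measure (\<Pi>\<^sub>M i\<in>?V. \<mu>) \<dots> = measure P {\<omega> \<in> space P. ?Q (compose ?V X \<omega>)}"
    unfolding P_def
  proof (rule prob_product_transfer[OF V _ M _ X' _ Q])
    show "prob_space \<mu>" using \<mu> by (simp add: \<P>\<S>_def)
    show "(\<lambda>x. x) \<in> measurable \<mu> ?B" by (simp add: \<mu>_def)
    show "distr \<mu> ?B (\<lambda>x. x) = distr M ?B X" unfolding \<mu>_def by (rule distr_id2) simp
  qed
  also have "{\<omega> \<in> space P. ?Q (compose ?V X \<omega>)} = {\<omega> \<in> space P. \<forall>(i, j)\<in>parcs F. W (X (\<omega> i)) (X (\<omega> j)) = 1}"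
    using pair_graph_arcs[OF F] by (force simp: compose_def)
  finally show "measure_density F \<mu> = measure P {\<omega> \<in> space P. \<forall>(i, j)\<in>parcs F. W (X (\<omega> i)) (X (\<omega> j)) = 1}" .
qed

text \<open>The intervals are lifted along the space-filling curve to reals in \<open>[0, 1]\<close>. There Helly's
selection theorem gives a weakly convergent subsequence, and Skorohod's theorem realizes it by
random reals that converge pointwise; the curve carries the pointwise convergence back to intervals.\<close>

lemma interval_laws_subsequence:
  fixes N :: "nat \<Rightarrow> nat" and f :: "nat \<Rightarrow> nat \<Rightarrow> real \<times> real"
  assumes f: "\<And>n i. i < N n \<Longrightarrow> f n i \<in> \<S>" and N0: "\<And>n. N n > 0"
  obtains r :: "nat \<Rightarrow> nat" and M :: "real measure" and Xs X
  where "strict_mono r" "prob_space M" "\<And>n. Xs n \<in> borel_measurable M" "X \<in> borel_measurable M"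
    "\<And>n. distr M borel (Xs n) = distr (measure_pmf (pmf_of_set {..<N (r n)})) borel (f (r n))"
    "\<And>\<omega>. X \<omega> \<in> \<S>" "\<And>\<omega>. \<omega> \<in> space M \<Longrightarrow> (\<lambda>n. Xs n \<omega>) \<longlonglongrightarrow> X \<omega>"
proof -
  obtain \<psi> :: "real \<Rightarrow> real \<times> real" where \<psi>: "continuous_on UNIV \<psi>" "\<And>t. \<psi> t \<in> \<S>"
    and onto: "\<And>p. p \<in> \<S> \<Longrightarrow> \<exists>t. 0 \<le> t \<and> t \<le> 1 \<and> \<psi> t = p"
    using segment_curve by metis
  have \<psi>_meas [measurable]: "\<psi> \<in> borel_measurable borel"
    using \<psi>(1) by (rule borel_measurable_continuous_onI)
  have "\<forall>n i. \<exists>t. 0 \<le> t \<and> t \<le> 1 \<and> (i < N n \<longrightarrow> \<psi> t = f n i)"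
    using onto f by (metis order_refl zero_le_one)
  then obtain g where g: "\<And>n i. 0 \<le> g n i" "\<And>n i. g n i \<le> 1" "\<And>n i. i < N n \<Longrightarrow> \<psi> (g n i) = f n i"
    by metis
  let ?p = "\<lambda>n. measure_pmf (pmf_of_set {..<N n})"
  define \<nu> where "\<nu> n = distr (?p n) borel (g n)" for n
  have rd: "real_distribution (\<nu> n)" for n
    unfolding \<nu>_def real_distribution_def real_distribution_axioms_def
    by (auto intro!: prob_space.prob_space_distr prob_space_measure_pmf)
  have "tight \<nu>"
    unfolding tight_def
  proof (intro conjI allI impI rd)
    fix \<epsilon> :: real assume \<epsilon>: "0 < \<epsilon>"
    have "measure (\<nu> n) {-1<..1} = 1" for n
    proof -
      have g': "-1 < g n i" for i using g(1)[of n i] by simp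
      have "measure (\<nu> n) {-1<..1} = measure (?p n) (g n -` {-1<..1} \<inter> space (?p n))"
        unfolding \<nu>_def by (rule measure_distr) auto
      also have "g n -` {-1<..1} \<inter> space (?p n) = UNIV"
        using g' g(2) by auto
      finally show ?thesis by simp
    qed
    then show "\<exists>a b. a < b \<and> (\<forall>n. 1 - \<epsilon> < measure (\<nu> n) {a<..b})"
      using \<epsilon> by (intro exI[of _ "-1"] exI[of _ 1]) auto
  qed
  from tight_imp_convergent_subsubsequence[OF this strict_mono_id]
  obtain r M0 where r: "strict_mono r" and M0: "real_distribution M0"
    and conv: "weak_conv_m (\<lambda>n. \<nu> (r n)) M0"
    by (auto simp: o_def)
  obtain M :: "real measure" and Ys Y where M: "prob_space M"
    and Ys: "\<And>n. Ys n \<in> borel_measurable M" "\<And>n. distr M borel (Ys n) = \<nu> (r n)"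
    and Y: "Y \<in> borel_measurable M"
    and lim: "\<And>\<omega>. \<omega> \<in> space M \<Longrightarrow> (\<lambda>n. Ys n \<omega>) \<longlonglongrightarrow> Y \<omega>"
    using Skorohod[OF rd M0 conv] unfolding measurable_lborel1 by metis
  note [measurable] = Ys(1) Y
  show ?thesis
  proof (rule that[of r M "\<lambda>n \<omega>. \<psi> (Ys n \<omega>)" "\<lambda>\<omega>. \<psi> (Y \<omega>)"])
    show "(\<lambda>\<omega>. \<psi> (Ys n \<omega>)) \<in> borel_measurable M" for n by measurable
    show "(\<lambda>\<omega>. \<psi> (Y \<omega>)) \<in> borel_measurable M" by measurable
    show "(\<lambda>n. \<psi> (Ys n \<omega>)) \<longlonglongrightarrow> \<psi> (Y \<omega>)" if "\<omega> \<in> space M" for \<omega>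
      using lim[OF that] by (intro continuous_on_tendsto_compose[OF \<psi>(1)]) auto
    show "distr M borel (\<lambda>\<omega>. \<psi> (Ys n \<omega>)) = distr (?p (r n)) borel (f (r n))" for n
    proof -
      have "distr M borel (\<lambda>\<omega>. \<psi> (Ys n \<omega>)) = distr (distr M borel (Ys n)) borel \<psi>"
        by (subst distr_distr) (auto simp: o_def)
      also have "\<dots> = distr (?p (r n)) borel (\<lambda>i. \<psi> (g (r n) i))"
        unfolding Ys(2) \<nu>_def by (subst distr_distr) (auto simp: o_def)
      also have "\<dots> = distr (?p (r n)) borel (f (r n))"
      \<comment> \<open>The lift is a lift only at indices below N (r n), but these carry all the mass.\<close>
      proof (intro measure_eqI)
        fix A assume A: "A \<in> sets (distr (?p (r n)) borel (\<lambda>i. \<psi> (g (r n) i)))"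
        have "AE i in ?p (r n). i < N (r n)"
          using N0[of "r n"] by (intro AE_pmfI) (auto simp: set_pmf_of_set lessThan_empty_iff)
        then have "AE i in ?p (r n). i \<in> (\<lambda>i. \<psi> (g (r n) i)) -` A \<longleftrightarrow> i \<in> f (r n) -` A"
          by eventually_elim (simp add: g(3))
        then have "emeasure (?p (r n)) ((\<lambda>i. \<psi> (g (r n) i)) -` A) = emeasure (?p (r n)) (f (r n) -` A)"
          by (intro emeasure_eq_AE) auto
        then show "emeasure (distr (?p (r n)) borel (\<lambda>i. \<psi> (g (r n) i))) A
            = emeasure (distr (?p (r n)) borel (f (r n))) A"
          using A by (simp add: emeasure_distr)
      qed simp
      finally show ?thesis .
    qed
  qed (use r M \<psi>(2) in auto)
qed

text \<open>The vertex intervals of the graphs converge along a subsequence to a random interval, and its law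
represents the limit. Spacing the left endpoints evenly is essential: it makes their limit law
atomless, and thus \<open>W\<close> almost surely continuous.\<close>

theorem interval_limit_representation:
  fixes H :: "nat \<Rightarrow> 'a pair_pre_digraph"
  assumes e: "\<And>n. interval_ordering (H n) (e n)" and N0: "\<And>n. card (pverts (H n)) > 0"
    and N: "filterlim (\<lambda>n. card (pverts (H n))) at_top sequentially"
    and lim: "\<And>F. pair_graph F \<Longrightarrow> (\<lambda>n. hom_density F (H n)) \<longlonglongrightarrow> limit_density \<Gamma> F"
  obtains \<mu> where "\<mu> \<in> \<P>\<S>" "is_limit_of_measure \<mu> \<Gamma>"
proof -
  let ?N = "\<lambda>n. card (pverts (H n))"
  let ?f = "\<lambda>n. vertex_interval (H n) (e n)"
  obtain r :: "nat \<Rightarrow> nat" and M :: "real measure" and Xs X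
    where r: "strict_mono r" and M: "prob_space M"
      and Xs: "\<And>n. Xs n \<in> borel_measurable M" and X: "X \<in> borel_measurable M"
      and law: "\<And>n. distr M borel (Xs n) = distr (measure_pmf (pmf_of_set {..<?N (r n)})) borel (?f (r n))"
      and XS: "\<And>\<omega>. X \<omega> \<in> \<S>" and conv: "\<And>\<omega>. \<omega> \<in> space M \<Longrightarrow> (\<lambda>n. Xs n \<omega>) \<longlonglongrightarrow> X \<omega>"
    using interval_laws_subsequence[of ?N ?f] vertex_interval_in_S N0 by metis
  note [measurable] = Xs X
  have atomless: "measure M {\<omega> \<in> space M. fst (X \<omega>) = a} = 0" for a
  proof (rule atomless_limit_of_grids[OF M, where Xs = "\<lambda>n \<omega>. fst (Xs n \<omega>)" and N = "\<lambda>n. ?N (r n)"])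
    show "(\<lambda>n. fst (Xs n \<omega>)) \<longlonglongrightarrow> fst (X \<omega>)" if "\<omega> \<in> space M" for \<omega>
      using conv[OF that] by (rule tendsto_fst)
    show "filterlim (\<lambda>n. ?N (r n)) at_top sequentially"
      by (rule filterlim_compose[OF N filterlim_subseq[OF r]])
    show "distr M borel (\<lambda>\<omega>. fst (Xs n \<omega>))
        = distr (measure_pmf (pmf_of_set {..<?N (r n)})) borel (\<lambda>i. real i / real (?N (r n)))" for n
    proof -
      have "distr M borel (\<lambda>\<omega>. fst (Xs n \<omega>)) = distr (distr M borel (Xs n)) borel fst"
        by (subst distr_distr) (auto simp: o_def borel_measurable_coords)
      also have "\<dots> = distr (measure_pmf (pmf_of_set {..<?N (r n)})) borel (\<lambda>i. real i / real (?N (r n)))"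
        unfolding law
        by (subst distr_distr) (auto simp: o_def vertex_interval_def borel_measurable_coords)
      finally show ?thesis .
    qed
  qed (use N0 law in \<open>auto intro: borel_measurable_coords Xs X\<close>)
  let ?\<mu> = "distr M (restrict_space borel \<S>) X"
  have "limit_density \<Gamma> F = measure_density F ?\<mu>" if F: "pair_graph F" for F
  proof -
    have "(\<lambda>n. hom_density F (H (r n))) \<longlonglongrightarrow> measure_density F ?\<mu>"
      unfolding measure_density_distr[OF F M X XS] hom_density_eq_prob[OF F e N0 M Xs law]
      by (rule prob_meet_limit[OF F M Xs X XS conv atomless])
    moreover have "(\<lambda>n. hom_density F (H (r n))) \<longlonglongrightarrow> limit_density \<Gamma> F"
      using LIMSEQ_subseq_LIMSEQ[OF lim[OF F] r] by (simp add: o_def)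
    ultimately show ?thesis by (intro LIMSEQ_unique)
  qed
  moreover have "?\<mu> \<in> \<P>\<S>"
    by (rule distr_in_PS[OF M X XS])
  ultimately show ?thesis using that by (auto simp: is_limit_of_measure_def)
qed

section \<open>Convergence of the clique number\<close>

theorem theorem4p2:
  fixes G :: "nat \<Rightarrow> 'a pair_pre_digraph" and \<Gamma> :: graph_limit
  assumes "\<And>n. n \<ge> 1 \<Longrightarrow> interval_graph (G n)"
    and "\<And>n. n \<ge> 1 \<Longrightarrow> card (pverts (G n)) = n"
    and "converges_to_limit G \<Gamma>"
  shows "(\<forall>n\<ge>1. real (chromatic_number (G n)) / real n = real (clique_number (G n)) / real n) \<and>
         (\<lambda>n. real (clique_number (G n)) / real n) \<longlonglongrightarrow> limit_clique_number \<Gamma>"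
proof
  show "\<forall>n\<ge>1. real (chromatic_number (G n)) / real n = real (clique_number (G n)) / real n"
  proof (intro allI impI)
    fix n :: nat assume "n \<ge> 1"
    then obtain e where "interval_ordering (G n) e"
      using interval_graph_imp_ordering[OF assms(1)] by blast
    then show "real (chromatic_number (G n)) / real n = real (clique_number (G n)) / real n"
      by (simp add: interval_ordering_chromatic)
  qed
  define H where "H n = G (Suc n)" for n
  have card: "card (pverts (H n)) = Suc n" for n using assms(2) by (simp add: H_def)
  have "\<forall>n. \<exists>e. interval_ordering (H n) e"
  proof
    fix n show "\<exists>e. interval_ordering (H n) e"
      using interval_graph_imp_ordering[OF assms(1)[of "Suc n"]] unfolding H_def by auto
  qed
  then obtain e where e: "\<And>n. interval_ordering (H n) (e n)" by metis
  have G: "pair_graph (H n)" for n using e by (simp add: interval_ordering_def)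
  have lim: "(\<lambda>n. hom_density F (H n)) \<longlonglongrightarrow> limit_density \<Gamma> F" if "pair_graph F" for F
    using assms(3) that unfolding converges_to_limit_def H_def by (intro LIMSEQ_Suc) simp
  have Suc_top: "filterlim Suc at_top sequentially" by (simp add: filterlim_Suc)
  have "\<exists>\<mu>. \<mu> \<in> \<P>\<S> \<and> is_limit_of_measure \<mu> \<Gamma>"
  proof -
    have "card (pverts (H n)) > 0" for n by (simp add: card)
    moreover have "filterlim (\<lambda>n. card (pverts (H n))) at_top sequentially"
      using Suc_top by (simp add: card)
    ultimately obtain \<mu> where "\<mu> \<in> \<P>\<S>" "is_limit_of_measure \<mu> \<Gamma>"
      using interval_limit_representation[OF e _ _ lim] by metis
    then show ?thesis by blast
  qed
  define \<mu> where "\<mu> = (SOME \<mu>. \<mu> \<in> \<P>\<S> \<and> is_limit_of_measure \<mu> \<Gamma>)"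
  \<comment> \<open>The bounds below hold for every representing measure, so the choice made by SOME is harmless.\<close>
  from someI_ex[OF \<open>\<exists>\<mu>. \<mu> \<in> \<P>\<S> \<and> is_limit_of_measure \<mu> \<Gamma>\<close>]
  have \<mu>: "\<mu> \<in> \<P>\<S>" "is_limit_of_measure \<mu> \<Gamma>" by (auto simp: \<mu>_def)
  have "(\<lambda>n. real (clique_number (H n)) / real (Suc n)) \<longlonglongrightarrow> measure_clique_number \<mu>"
  proof (rule clique_density_squeeze[where N = "\<lambda>n. real (Suc n)"
        and t = "\<lambda>m n. hom_density (complete_graph (Suc m)) (H n)"
        and T = "\<lambda>m. limit_density \<Gamma> (complete_graph (Suc m))"])
    show "0 \<le> measure_clique_number \<mu>" by (rule measure_clique_number_bounds[OF \<mu>(1)])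
    show "filterlim (\<lambda>n. real (Suc n)) at_top sequentially"
      by (rule filterlim_compose[OF filterlim_real_sequentially Suc_top])
    fix m
    have T: "limit_density \<Gamma> (complete_graph (Suc m)) = measure_density (complete_graph (Suc m)) \<mu>"
      using \<mu>(2) pair_graph_complete_graph by (simp add: is_limit_of_measure_def)
    show "measure_clique_number \<mu> ^ Suc m \<le> limit_density \<Gamma> (complete_graph (Suc m))"
      "limit_density \<Gamma> (complete_graph (Suc m)) \<le> real (Suc m) * measure_clique_number \<mu> ^ m"
      unfolding T by (rule measure_density_complete_lower[OF \<mu>(1)] measure_density_complete_upper[OF \<mu>(1)])+
    show "(\<lambda>n. hom_density (complete_graph (Suc m)) (H n)) \<longlonglongrightarrow> limit_density \<Gamma> (complete_graph (Suc m))"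
      by (rule lim[OF pair_graph_complete_graph])
    fix n
    show "hom_density (complete_graph (Suc m)) (H n)
        \<le> real (Suc m) * (real (clique_number (H n)) / real (Suc n)) ^ m"
      using hom_density_complete_upper[OF e[of n], of m] by (simp add: card)
    assume le: "real (Suc m) / real (Suc n) \<le> real (clique_number (H n)) / real (Suc n)"
    then have "Suc m \<le> clique_number (H n)" by (simp add: divide_le_cancel)
    then show "(real (clique_number (H n)) / real (Suc n) - real (Suc m) / real (Suc n)) ^ Suc m
        \<le> hom_density (complete_graph (Suc m)) (H n)"
      using hom_density_complete_lower[OF G, of "Suc m" n] unfolding card
      by (simp add: diff_divide_distrib)
  qed simp
  then have "(\<lambda>n. real (clique_number (G n)) / real n) \<longlonglongrightarrow> measure_clique_number \<mu>"
    unfolding H_def by (rule LIMSEQ_imp_Suc)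
  then show "(\<lambda>n. real (clique_number (G n)) / real n) \<longlonglongrightarrow> limit_clique_number \<Gamma>"
    unfolding limit_clique_number_def \<mu>_def .
qed

end
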